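(* Let $n\ge 2$, $p\ge1$ and $m\ge 2p$. For $u\in\mathcal{P}_m(\mathbb{R}^n)$ let $u_0,\dots,u_{[m/2]}$ be the polynomials associated with $u$ as described in the context. Then the mapping $Q\colon\mathcal{P}_m(\mathbb{R}^n)\to\mathcal{H}_m^p(\mathbb{R}^n)$ of the form $$Q[u](x)=\begin{cases}\displaystyle\sum_{k=0}^{p-1}\frac{|x|^{2k}}{c_{m-2k}}K[u_k(D)|x|^{2-n}] & \text{for } n>2,\\[3mm] \displaystyle\sum_{k=0}^{p-1}\frac{|x|^{2k}}{\tilde c_{m-2k}}K[u_k(D)\log|x|] & \text{for } n=2\end{cases}$$ is the canonical projection of $\mathcal{P}_m(\mathbb{R}^n)$ onto $\mathcal{H}_m^p(\mathbb{R}^n)$, and it extends in a natural way (by complexification of polynomials) to the canonical projection $\tilde Q$ of $\mathcal{P}_m(\mathbb{C}^n)$ onto $\mathcal{H}_m^p(\mathbb{C}^n)$.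
   Context: $\mathcal{P}_m(\mathbb{R}^n)$ (resp. $\mathcal{P}_m(\mathbb{C}^n)$) is the space of homogeneous polynomials of degree $m$ on $\mathbb{R}^n$ (resp. on $\mathbb{C}^n$), with complex coefficients, including zero; $\mathcal{H}_m^p(\mathbb{R}^n)$ (resp. $\mathcal{H}_m^p(\mathbb{C}^n)$) is the subspace of those $q$ with $\Delta^p q=0$, where $\Delta=\sum_j\partial^2/\partial x_j^2$ (resp. $\sum_j\partial^2/\partial z_j^2$). For $z\in\mathbb{C}^n$, $|z|=(\sum_j z_j^2)^{1/2}$, so $|z|^2=\sum_j z_j^2$ is a polynomial. The canonical projection onto $\mathcal{H}_m^p$ is the projection onto the first summand in the unique decomposition $\mathcal{P}_m=\mathcal{H}_m^p\oplus|x|^{2p}\mathcal{P}_{m-2p}$ (over $\mathbb{R}^n$, and likewise over $\mathbb{C}^n$ with $|z|^{2p}$). The natural extension is $\tilde Q[u]=$ the complexification (same coefficients) of $Q[u|_{\mathbb{R}^n}]$, $u\in\mathcal{P}_m(\mathbb{C}^n)$. $\mathbb{N}_0=\{0,1,2,\dots\}$; $[\cdot]$ is the integer part. For $w=\sum_\alpha a_\alpha x^\alpha$, $w(D)=\sum_\alpha a_\alpha D^\alpha$. $D^{2k}_{x_1^{2k_1},\dots,x_n^{2k_n}}u=\partial^{2k}u/\partial x_1^{2k_1}\cdots\partial x_n^{2k_n}$. The Kelvin transform is $K[f](x)=|x|^{2-n}f(x/|x|^2)$ for $f$ on $\mathbb{R}^n\setminus\{0\}$; a function on $\mathbb{R}^n\setminus\{0\}$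 agreeing there with a polynomial is identified with that polynomial. $c_m=\prod_{k=0}^{m-1}(2-n-2k)$ and, for $m\ge1$, $\tilde c_m=(-2)^{m-1}(m-1)!$. The polynomials $u_k$: there exist constants $d_{m,k,k_1,\dots,k_n}$, independent of $u$, such that for every $u\in\mathcal{P}_m(\mathbb{R}^n)$, with $u_0=u$ and $$u_k=\sum_{\substack{(k_1,\dots,k_n)\in\mathbb{N}_0^n\\ k_1+\dots+k_n=k}}d_{m,k,k_1,\dots,k_n}D^{2k}_{x_1^{2k_1},\dots,x_n^{2k_n}}u\quad (1\le k\le[m/2]),$$ one has $u(x)=\sum_{k=0}^{[m/2]}\frac{|x|^{2k}}{c_{m-2k}}K[u_k(D)|x|^{2-n}]$ if $n>2$, and $u(x)=\sum_{k=0}^{[m/2]}\frac{|x|^{2k}}{\tilde c_{m-2k}}K[u_k(D)\log|x|]$ if $n=2$ (where, for $m$ even and $n=2$, the term $k=m/2$ is read as $|x|^m u_{m/2}$). Such constants are fixed once and for all. *)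

theory Defs
  imports "HOL-Analysis.Analysis" "HOL-Library.Poly_Mapping"
begin

text \<open>
  A formal polynomial \<open>\<Sum>\<^sub>\<alpha> a\<^sub>\<alpha> x\<^sup>\<alpha>\<close> is given by its finitely supported coefficient family,
  indexed by multi-indices \<open>\<alpha> :: 'n \<Rightarrow> nat\<close>.  Spaces of polynomials on \<open>\<real>\<^sup>n\<close> and on \<open>\<complex>\<^sup>n\<close>
  are spaces of functions, and hence distinct types.
\<close>

type_synonym 'n coeffs = "('n \<Rightarrow> nat) \<Rightarrow>\<^sub>0 complex"

definition cpoly :: "'n::finite coeffs \<Rightarrow> complex^'n \<Rightarrow> complex" where
  "cpoly a z = (\<Sum>\<alpha>\<in>Poly_Mapping.keys a. Poly_Mapping.lookup a \<alpha> * (\<Prod>i\<in>UNIV. (z $ i) ^ \<alpha> i))"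

definition of_real_vec :: "real^'n \<Rightarrow> complex^'n::finite" where
  "of_real_vec x = (\<chi> i. of_real (x $ i))"

definition rpoly :: "'n::finite coeffs \<Rightarrow> real^'n \<Rightarrow> complex" where
  "rpoly a x = cpoly a (of_real_vec x)"

definition homogeneous_coeffs :: "nat \<Rightarrow> 'n::finite coeffs \<Rightarrow> bool" where
  "homogeneous_coeffs m a \<longleftrightarrow> (\<forall>\<alpha>\<in>Poly_Mapping.keys a. sum \<alpha> UNIV = m)"

definition hom_polys_real :: "nat \<Rightarrow> (real^'n::finite \<Rightarrow> complex) set" where
  "hom_polys_real m = {rpoly a |a. homogeneous_coeffs m a}"

definition hom_polys_complex :: "nat \<Rightarrow> (complex^'n::finite \<Rightarrow> complex) set" where
  "hom_polys_complex m = {cpoly a |a. homogeneous_coeffs m a}"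

text \<open>The coefficients are determined by the function, since \<open>\<real>\<close> is infinite.\<close>

definition coeffs_of :: "(real^'n::finite \<Rightarrow> complex) \<Rightarrow> 'n coeffs" where
  "coeffs_of f = (THE a. rpoly a = f)"

definition complexify :: "(real^'n::finite \<Rightarrow> complex) \<Rightarrow> complex^'n \<Rightarrow> complex" where
  "complexify f = cpoly (coeffs_of f)"

text \<open>
  A function on \<open>\<real>\<^sup>n - {0}\<close> agreeing there with a polynomial is identified with that polynomial
  (values at \<open>0\<close> of the functions below are irrelevant).
\<close>

definition identify_poly :: "(real^'n::finite \<Rightarrow> complex) \<Rightarrow> real^'n \<Rightarrow> complex" where
  "identify_poly f = (THE q. q \<in> range rpoly \<and> (\<forall>x. x \<noteq> 0 \<longrightarrow> q x = f x))"

definition partial_real :: "'n::finite \<Rightarrow> (real^'n \<Rightarrow> complex) \<Rightarrow> real^'n \<Rightarrow> complex" where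
  "partial_real j f x = vector_derivative (\<lambda>t. f (x + t *\<^sub>R axis j 1)) (at 0)"

definition partial_complex :: "'n::finite \<Rightarrow> (complex^'n \<Rightarrow> complex) \<Rightarrow> complex^'n \<Rightarrow> complex" where
  "partial_complex j f z = deriv (\<lambda>t. f (z + t *s axis j 1)) 0"

text \<open>
  An enumeration of the coordinates. It only fixes the order of differentiation in \<open>D\<^sup>\<alpha>\<close>,
  which is immaterial because all functions differentiated below are smooth (at least on
  \<open>\<real>\<^sup>n - {0}\<close>).
\<close>

definition coords :: "'n::finite list" where
  "coords = (SOME js. distinct js \<and> set js = UNIV)"

definition multi_deriv :: "('n::finite \<Rightarrow> nat) \<Rightarrow> (real^'n \<Rightarrow> complex) \<Rightarrow> real^'n \<Rightarrow> complex" where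
  "multi_deriv \<alpha> f = foldr (\<lambda>j. partial_real j ^^ \<alpha> j) coords f"

text \<open>\<open>w(D) f\<close>, where \<open>w\<close> is a polynomial function.\<close>

definition poly_deriv ::
  "(real^'n::finite \<Rightarrow> complex) \<Rightarrow> (real^'n \<Rightarrow> complex) \<Rightarrow> real^'n \<Rightarrow> complex" where
  "poly_deriv w f x =
     (\<Sum>\<alpha>\<in>Poly_Mapping.keys (coeffs_of w). Poly_Mapping.lookup (coeffs_of w) \<alpha> * multi_deriv \<alpha> f x)"

definition laplacian_real :: "(real^'n::finite \<Rightarrow> complex) \<Rightarrow> real^'n \<Rightarrow> complex" where
  "laplacian_real f x = (\<Sum>j\<in>UNIV. partial_real j (partial_real j f) x)"

definition laplacian_complex :: "(complex^'n::finite \<Rightarrow> complex) \<Rightarrow> complex^'n \<Rightarrow> complex" where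
  "laplacian_complex f z = (\<Sum>j\<in>UNIV. partial_complex j (partial_complex j f) z)"

definition polyharmonic_real :: "nat \<Rightarrow> nat \<Rightarrow> (real^'n::finite \<Rightarrow> complex) set" where
  "polyharmonic_real p m = {q \<in> hom_polys_real m. (laplacian_real ^^ p) q = (\<lambda>x. 0)}"

definition polyharmonic_complex :: "nat \<Rightarrow> nat \<Rightarrow> (complex^'n::finite \<Rightarrow> complex) set" where
  "polyharmonic_complex p m = {q \<in> hom_polys_complex m. (laplacian_complex ^^ p) q = (\<lambda>z. 0)}"

text \<open>The unique decomposition \<open>V = A \<oplus> B\<close> is part of the definition.\<close>

definition is_projection_along ::
  "('x \<Rightarrow> complex) set \<Rightarrow> ('x \<Rightarrow> complex) set \<Rightarrow> ('x \<Rightarrow> complex) set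
    \<Rightarrow> (('x \<Rightarrow> complex) \<Rightarrow> ('x \<Rightarrow> complex)) \<Rightarrow> bool" where
  "is_projection_along V A B P \<longleftrightarrow>
     (\<forall>a\<in>A. \<forall>b\<in>B. (\<lambda>x. a x + b x) \<in> V) \<and>
     (\<forall>v\<in>V. \<exists>!ab. fst ab \<in> A \<and> snd ab \<in> B \<and> v = (\<lambda>x. fst ab x + snd ab x)) \<and>
     (\<forall>v\<in>V. P v \<in> A \<and> (\<exists>b\<in>B. v = (\<lambda>x. P v x + b x)))"

definition canonical_projection_real ::
  "nat \<Rightarrow> nat \<Rightarrow> ((real^'n::finite \<Rightarrow> complex) \<Rightarrow> (real^'n \<Rightarrow> complex)) \<Rightarrow> bool" where
  "canonical_projection_real p m P \<longleftrightarrow>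
     is_projection_along (hom_polys_real m) (polyharmonic_real p m)
       ((\<lambda>g x. of_real (norm x ^ (2 * p)) * g x) ` hom_polys_real (m - 2 * p)) P"

text \<open>Here \<open>|z|\<^sup>2\<close> is the polynomial \<open>\<Sum>\<^sub>j z\<^sub>j\<^sup>2\<close>, not the Hermitian norm.\<close>

definition canonical_projection_complex ::
  "nat \<Rightarrow> nat \<Rightarrow> ((complex^'n::finite \<Rightarrow> complex) \<Rightarrow> (complex^'n \<Rightarrow> complex)) \<Rightarrow> bool" where
  "canonical_projection_complex p m P \<longleftrightarrow>
     is_projection_along (hom_polys_complex m) (polyharmonic_complex p m)
       ((\<lambda>g z. (\<Sum>j\<in>UNIV. (z $ j)\<^sup>2) ^ p * g z) ` hom_polys_complex (m - 2 * p)) P"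

definition natural_extension ::
  "((real^'n::finite \<Rightarrow> complex) \<Rightarrow> (real^'n \<Rightarrow> complex))
    \<Rightarrow> (complex^'n \<Rightarrow> complex) \<Rightarrow> complex^'n \<Rightarrow> complex" where
  "natural_extension P u = complexify (P (u \<circ> of_real_vec))"

definition kelvin :: "(real^'n::finite \<Rightarrow> complex) \<Rightarrow> real^'n \<Rightarrow> complex" where
  "kelvin f x = of_real (norm x powi (2 - int CARD('n))) * f (x /\<^sub>R (norm x)\<^sup>2)"

definition c_const :: "nat \<Rightarrow> nat \<Rightarrow> real" where
  "c_const n m = (\<Prod>k<m. 2 - real n - 2 * real k)"

text \<open>Only meaningful for \<open>m \<ge> 1\<close>.\<close>

definition c_tilde :: "nat \<Rightarrow> real" where
  "c_tilde m = (- 2) ^ (m - 1) * fact (m - 1)"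

text \<open>\<open>kelvin_term m k w\<close> is the \<open>k\<close>-th summand, where \<open>w\<close> stands for \<open>u\<^sub>k\<close>.\<close>

definition kelvin_term ::
  "nat \<Rightarrow> nat \<Rightarrow> (real^'n::finite \<Rightarrow> complex) \<Rightarrow> real^'n \<Rightarrow> complex" where
  "kelvin_term m k w x =
     (if CARD('n) > 2 then
        of_real (norm x ^ (2 * k) / c_const CARD('n) (m - 2 * k)) *
          kelvin (poly_deriv w (\<lambda>y. of_real (norm y powi (2 - int CARD('n))))) x
      else if 2 * k = m then of_real (norm x ^ m) * w x
      else
        of_real (norm x ^ (2 * k) / c_tilde (m - 2 * k)) *
          kelvin (poly_deriv w (\<lambda>y. of_real (ln (norm y)))) x)"

text \<open>The polynomial \<open>u\<^sub>k\<close> for given constants \<open>d m k (k\<^sub>1, \<dots>, k\<^sub>n)\<close>.\<close>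

definition assoc_poly ::
  "(nat \<Rightarrow> nat \<Rightarrow> ('n::finite \<Rightarrow> nat) \<Rightarrow> complex) \<Rightarrow> nat \<Rightarrow> nat
    \<Rightarrow> (real^'n \<Rightarrow> complex) \<Rightarrow> real^'n \<Rightarrow> complex" where
  "assoc_poly d m k u =
     (if k = 0 then u
      else (\<lambda>x. \<Sum>\<kappa> | sum \<kappa> UNIV = k. d m k \<kappa> * multi_deriv (\<lambda>i. 2 * \<kappa> i) u x))"

definition representing_constants ::
  "nat \<Rightarrow> (nat \<Rightarrow> nat \<Rightarrow> ('n::finite \<Rightarrow> nat) \<Rightarrow> complex) \<Rightarrow> bool" where
  "representing_constants m d \<longleftrightarrow>
     (\<forall>u \<in> hom_polys_real m. \<forall>x. x \<noteq> 0 \<longrightarrow>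
        u x = (\<Sum>k\<le>m div 2. kelvin_term m k (assoc_poly d m k u) x))"

definition Q_formula ::
  "(nat \<Rightarrow> nat \<Rightarrow> ('n::finite \<Rightarrow> nat) \<Rightarrow> complex) \<Rightarrow> nat \<Rightarrow> nat
    \<Rightarrow> (real^'n \<Rightarrow> complex) \<Rightarrow> real^'n \<Rightarrow> complex" where
  "Q_formula d p m u x = (\<Sum>k<p. kelvin_term m k (assoc_poly d m k u) x)"

definition Q_map ::
  "(nat \<Rightarrow> nat \<Rightarrow> ('n::finite \<Rightarrow> nat) \<Rightarrow> complex) \<Rightarrow> nat \<Rightarrow> nat
    \<Rightarrow> (real^'n \<Rightarrow> complex) \<Rightarrow> real^'n \<Rightarrow> complex" where
  "Q_map d p m u = identify_poly (Q_formula d p m u)"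

end

theory Submission imports Defs begin

text \<open>
  Write \<open>n\<close> for the dimension.  Two facts carry the proof.

  \<^item> Each summand of the given expansion of \<open>u\<close> has the form \<open>|x|\<^sup>2\<^sup>k h\<^sub>k\<close> with \<open>h\<^sub>k\<close> a harmonic homogeneous
    polynomial of degree \<open>m - 2k\<close> (\<open>kelvin_term_rpoly\<close>).  Indeed, let \<open>f\<close> be \<open>|x|\<close> to the power \<open>2 - n\<close>, or
    \<open>log |x|\<close> if \<open>n = 2\<close>.  A derivative of \<open>f\<close> of order \<open>j\<close> (\<open>j > 0\<close> for the logarithm) equals
    \<open>h(x)\<close> times \<open>|x|\<close> to the power \<open>2 - n - 2j\<close> for a harmonic \<open>h\<close> of degree \<open>j\<close>: differentiating once
    more in direction \<open>i\<close> replaces \<open>h\<close> by \<open>|x|\<^sup>2 \<partial>\<^sub>i h + (2 - n - 2j) x\<^sub>i h\<close>, and a computation with Euler's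
    identity shows that this polynomial is harmonic again (\<open>laplace_raised_harmonic\<close>).  The Kelvin
    transform removes the power of \<open>|x|\<close> and leaves \<open>h\<close>.  The sum over \<open>k < p\<close> is therefore annihilated
    by \<open>\<Delta>\<^sup>p\<close>, because \<open>\<Delta>(|x|\<^sup>2\<^sup>k h)\<close> is a multiple of \<open>|x|\<^sup>2\<^sup>k\<^sup>-\<^sup>2 h\<close>, and the sum over \<open>k \<ge> p\<close> is divisible by
    \<open>|x|\<^sup>2\<^sup>p\<close>.  So the expansion itself splits \<open>u\<close> as required (\<open>Q_map_rpoly\<close>).

  \<^item> The splitting is unique.  In the Fischer inner product \<open>\<langle>a, b\<rangle> = \<Sum>\<^sub>\<alpha> \<alpha>! a\<^sub>\<alpha> cnj b\<^sub>\<alpha>\<close>, multiplication by \<open>x\<^sub>i\<close> is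
    adjoint to \<open>\<partial>\<^sub>i\<close>, hence multiplication by \<open>|x|\<^sup>2\<^sup>p\<close> is adjoint to \<open>\<Delta>\<^sup>p\<close>.  If \<open>\<Delta>\<^sup>p(|x|\<^sup>2\<^sup>p g) = 0\<close>, then
    \<open>|x|\<^sup>2\<^sup>p g\<close> is orthogonal to itself and vanishes (\<open>polyharmonic_multiple_of_normsq_eq_0\<close>).

  All the algebra is done on coefficient families.  Evaluation on \<open>\<real>\<^sup>n\<close> and on \<open>\<complex>\<^sup>n\<close> are both injective
  and intertwine the formal operators with the analytic ones, so one argument about coefficients
  (\<open>is_projection_along_coeffs\<close>) gives the real and the complex projection at once.
\<close>

section \<open>Operators on coefficient families\<close>

abbreviation lookup :: "'n coeffs \<Rightarrow> ('n \<Rightarrow> nat) \<Rightarrow> complex" where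
  "lookup \<equiv> Poly_Mapping.lookup"
abbreviation keys :: "'n coeffs \<Rightarrow> ('n \<Rightarrow> nat) set" where
  "keys \<equiv> Poly_Mapping.keys"

lift_definition scale_coeffs :: "complex \<Rightarrow> 'n::finite coeffs \<Rightarrow> 'n coeffs"
  is "\<lambda>c a \<alpha>. c * a \<alpha>"
  by (erule rev_finite_subset) auto

lift_definition times_var :: "'n::finite \<Rightarrow> 'n coeffs \<Rightarrow> 'n coeffs"
  is "\<lambda>i a \<alpha>. if \<alpha> i = 0 then 0 else a (\<alpha>(i := \<alpha> i - 1))"
proof -
  fix i :: 'n and a :: "('n \<Rightarrow> nat) \<Rightarrow> complex"
  assume fin: "finite {\<alpha>. a \<alpha> \<noteq> 0}"
  have "{\<alpha>. (if \<alpha> i = 0 then 0 else a (\<alpha>(i := \<alpha> i - 1))) \<noteq> 0}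
      \<subseteq> (\<lambda>\<alpha>. \<alpha>(i := Suc (\<alpha> i))) ` {\<alpha>. a \<alpha> \<noteq> 0}"
  proof
    fix \<alpha> assume "\<alpha> \<in> {\<alpha>. (if \<alpha> i = 0 then 0 else a (\<alpha>(i := \<alpha> i - 1))) \<noteq> 0}"
    then show "\<alpha> \<in> (\<lambda>\<alpha>. \<alpha>(i := Suc (\<alpha> i))) ` {\<alpha>. a \<alpha> \<noteq> 0}"
      by (intro image_eqI[of _ _ "\<alpha>(i := \<alpha> i - 1)"]) (auto split: if_splits)
  qed
  then show "finite {\<alpha>. (if \<alpha> i = 0 then 0 else a (\<alpha>(i := \<alpha> i - 1))) \<noteq> 0}"
    using fin finite_subset by blast
qed

lift_definition deriv_var :: "'n::finite \<Rightarrow> 'n coeffs \<Rightarrow> 'n coeffs"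
  is "\<lambda>i a \<alpha>. of_nat (Suc (\<alpha> i)) * a (\<alpha>(i := Suc (\<alpha> i)))"
proof -
  fix i :: 'n and a :: "('n \<Rightarrow> nat) \<Rightarrow> complex"
  assume fin: "finite {\<alpha>. a \<alpha> \<noteq> 0}"
  have "{\<alpha>. of_nat (Suc (\<alpha> i)) * a (\<alpha>(i := Suc (\<alpha> i))) \<noteq> 0}
      \<subseteq> (\<lambda>\<alpha>. \<alpha>(i := \<alpha> i - 1)) ` {\<alpha>. a \<alpha> \<noteq> 0}"
  proof
    fix \<alpha> assume "\<alpha> \<in> {\<alpha>. of_nat (Suc (\<alpha> i)) * a (\<alpha>(i := Suc (\<alpha> i))) \<noteq> 0}"
    then show "\<alpha> \<in> (\<lambda>\<alpha>. \<alpha>(i := \<alpha> i - 1)) ` {\<alpha>. a \<alpha> \<noteq> 0}"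
      by (intro image_eqI[of _ _ "\<alpha>(i := Suc (\<alpha> i))"]) auto
  qed
  then show "finite {\<alpha>. of_nat (Suc (\<alpha> i)) * a (\<alpha>(i := Suc (\<alpha> i))) \<noteq> 0}"
    using fin finite_subset by blast
qed

definition times_normsq :: "'n::finite coeffs \<Rightarrow> 'n coeffs" where
  "times_normsq a = (\<Sum>i\<in>UNIV. times_var i (times_var i a))"

definition laplace :: "'n::finite coeffs \<Rightarrow> 'n coeffs" where
  "laplace a = (\<Sum>i\<in>UNIV. deriv_var i (deriv_var i a))"

lemmas lookup_ops = scale_coeffs.rep_eq times_var.rep_eq deriv_var.rep_eq lookup_add lookup_sum

lemma times_var_add: "times_var i (a + b) = times_var i a + times_var i b"
  by (rule poly_mapping_eqI) (simp add: lookup_ops)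

lemma deriv_var_add: "deriv_var i (a + b) = deriv_var i a + deriv_var i b"
  by (rule poly_mapping_eqI) (simp add: lookup_ops algebra_simps)

lemma times_var_scale: "times_var i (scale_coeffs c a) = scale_coeffs c (times_var i a)"
  by (rule poly_mapping_eqI) (simp add: lookup_ops)

lemma deriv_var_scale: "deriv_var i (scale_coeffs c a) = scale_coeffs c (deriv_var i a)"
  by (rule poly_mapping_eqI) (simp add: lookup_ops)

lemma times_var_0 [simp]: "times_var i 0 = 0"
  by (rule poly_mapping_eqI) (simp add: lookup_ops)

lemma deriv_var_0 [simp]: "deriv_var i 0 = 0"
  by (rule poly_mapping_eqI) (simp add: lookup_ops)

lemma scale_coeffs_0 [simp]: "scale_coeffs c 0 = 0"
  by (rule poly_mapping_eqI) (simp add: lookup_ops)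

lemma scale_coeffs_sum: "scale_coeffs c (\<Sum>i\<in>I. f i) = (\<Sum>i\<in>I. scale_coeffs c (f i))"
  by (rule poly_mapping_eqI) (simp add: lookup_ops sum_distrib_left)

lemma times_var_sum: "times_var i (\<Sum>j\<in>I. f j) = (\<Sum>j\<in>I. times_var i (f j))"
  by (induction I rule: infinite_finite_induct) (auto simp: times_var_add)

lemma deriv_var_sum: "deriv_var i (\<Sum>j\<in>I. f j) = (\<Sum>j\<in>I. deriv_var i (f j))"
  by (induction I rule: infinite_finite_induct) (auto simp: deriv_var_add)

text \<open>
  The Weyl algebra relation \<open>[\<partial>\<^sub>i, x\<^sub>j] = \<delta>\<^sub>i\<^sub>j\<close>, from which the commutators below follow formally.
\<close>

lemma deriv_var_times_var:
  "deriv_var i (times_var j a) = times_var j (deriv_var i a) + (if i = j then a else 0)"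
  by (rule poly_mapping_eqI) (auto simp: lookup_ops fun_upd_twist fun_upd_idem algebra_simps)

lemma deriv_var_commute: "deriv_var i (deriv_var j a) = deriv_var j (deriv_var i a)"
  by (rule poly_mapping_eqI) (cases "i = j"; simp add: lookup_ops fun_upd_twist)

lemma times_normsq_add: "times_normsq (a + b) = times_normsq a + times_normsq b"
  by (simp add: times_normsq_def times_var_add sum.distrib)

lemma times_normsq_scale: "times_normsq (scale_coeffs c a) = scale_coeffs c (times_normsq a)"
  by (simp add: times_normsq_def times_var_scale scale_coeffs_sum)

lemma times_normsq_0 [simp]: "times_normsq 0 = 0"
  by (simp add: times_normsq_def)

lemma times_normsq_sum: "times_normsq (\<Sum>j\<in>I. f j) = (\<Sum>j\<in>I. times_normsq (f j))"
  by (induction I rule: infinite_finite_induct) (auto simp: times_normsq_add)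

lemma laplace_add: "laplace (a + b) = laplace a + laplace b"
  by (simp add: laplace_def deriv_var_add sum.distrib)

lemma laplace_scale: "laplace (scale_coeffs c a) = scale_coeffs c (laplace a)"
  by (simp add: laplace_def deriv_var_scale scale_coeffs_sum)

lemma laplace_0 [simp]: "laplace 0 = 0"
  by (simp add: laplace_def)

lemma laplace_sum: "laplace (\<Sum>j\<in>I. f j) = (\<Sum>j\<in>I. laplace (f j))"
  by (induction I rule: infinite_finite_induct) (auto simp: laplace_add)

lemma laplace_pow_0 [simp]: "(laplace ^^ k) 0 = 0"
  by (induction k) auto

lemma laplace_pow_scale: "(laplace ^^ k) (scale_coeffs c a) = scale_coeffs c ((laplace ^^ k) a)"
  by (induction k) (auto simp: laplace_scale)

lemma laplace_pow_add: "(laplace ^^ k) (a + b) = (laplace ^^ k) a + (laplace ^^ k) b"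
  by (induction k) (auto simp: laplace_add)

lemma laplace_pow_sum: "(laplace ^^ k) (\<Sum>j\<in>I. f j) = (\<Sum>j\<in>I. (laplace ^^ k) (f j))"
  by (induction k) (auto simp: laplace_sum)

lemma times_normsq_pow_add:
  "(times_normsq ^^ k) (a + b) = (times_normsq ^^ k) a + (times_normsq ^^ k) b"
  by (induction k) (auto simp: times_normsq_add)

lemma times_normsq_pow_scale:
  "(times_normsq ^^ k) (scale_coeffs c a) = scale_coeffs c ((times_normsq ^^ k) a)"
  by (induction k) (auto simp: times_normsq_scale)

lemma times_normsq_pow_0 [simp]: "(times_normsq ^^ k) 0 = 0"
  by (induction k) auto

lemma times_normsq_pow_sum:
  "(times_normsq ^^ k) (\<Sum>j\<in>I. f j) = (\<Sum>j\<in>I. (times_normsq ^^ k) (f j))"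
  by (induction I rule: infinite_finite_induct) (auto simp: times_normsq_pow_add)

lemma laplace_deriv_var: "laplace (deriv_var i a) = deriv_var i (laplace a)"
  by (simp add: laplace_def deriv_var_sum deriv_var_commute[of i])

lemma laplace_times_var: "laplace (times_var i a) = times_var i (laplace a) + scale_coeffs 2 (deriv_var i a)"
proof -
  have "deriv_var j (deriv_var j (times_var i a)) =
      times_var i (deriv_var j (deriv_var j a)) + (if j = i then scale_coeffs 2 (deriv_var i a) else 0)" for j
    by (rule poly_mapping_eqI)
      (auto simp: deriv_var_times_var deriv_var_add lookup_add scale_coeffs.rep_eq)
  then show ?thesis
    by (simp add: laplace_def times_var_sum sum.distrib)
qed

lemma deriv_var_times_normsq:
  "deriv_var i (times_normsq a) = times_normsq (deriv_var i a) + scale_coeffs 2 (times_var i a)"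
proof -
  have "deriv_var i (times_var j (times_var j a)) =
      times_var j (times_var j (deriv_var i a)) + (if i = j then scale_coeffs 2 (times_var i a) else 0)" for j
    by (rule poly_mapping_eqI)
      (auto simp: deriv_var_times_var times_var_add lookup_add scale_coeffs.rep_eq)
  then show ?thesis
    by (simp add: times_normsq_def deriv_var_sum sum.distrib)
qed

definition euler :: "'n::finite coeffs \<Rightarrow> 'n coeffs" where
  "euler a = (\<Sum>i\<in>UNIV. times_var i (deriv_var i a))"

lemma lookup_euler: "lookup (euler a) \<alpha> = of_nat (sum \<alpha> UNIV) * lookup a \<alpha>"
proof -
  have "lookup (times_var i (deriv_var i a)) \<alpha> = of_nat (\<alpha> i) * lookup a \<alpha>" for i
    by (auto simp: lookup_ops)
  then show ?thesis
    by (simp add: euler_def lookup_sum sum_distrib_right)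
qed

text \<open>
  The commutator of \<open>\<Delta>\<close> and \<open>|x|\<^sup>2\<close> is \<open>4E + 2n\<close> with the Euler operator \<open>E\<close>, obtained by summing
  \<open>[\<partial>\<^sub>i\<^sup>2, |x|\<^sup>2] = 4 x\<^sub>i \<partial>\<^sub>i + 2\<close> over \<open>i\<close>.
\<close>

lemma laplace_times_normsq:
  "laplace (times_normsq a) = times_normsq (laplace a) + scale_coeffs 4 (euler a)
     + scale_coeffs (2 * of_nat CARD('n)) a"
  for a :: "'n::finite coeffs"
proof -
  have "deriv_var i (deriv_var i (times_normsq a)) = times_normsq (deriv_var i (deriv_var i a))
      + (scale_coeffs 4 (times_var i (deriv_var i a)) + scale_coeffs 2 a)" for i
    by (rule poly_mapping_eqI)
      (simp add: deriv_var_times_normsq deriv_var_add deriv_var_scale deriv_var_times_var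
         lookup_add scale_coeffs.rep_eq algebra_simps)
  then have "laplace (times_normsq a) = (\<Sum>i\<in>UNIV. times_normsq (deriv_var i (deriv_var i a)))
      + ((\<Sum>i\<in>UNIV. scale_coeffs 4 (times_var i (deriv_var i a))) + (\<Sum>i\<in>(UNIV :: 'n set). scale_coeffs 2 a))"
    by (simp add: laplace_def sum.distrib)
  also have "(\<Sum>i\<in>UNIV. times_normsq (deriv_var i (deriv_var i a))) = times_normsq (laplace a)"
    by (simp add: laplace_def times_normsq_sum)
  also have "(\<Sum>i\<in>UNIV. scale_coeffs 4 (times_var i (deriv_var i a))) = scale_coeffs 4 (euler a)"
    by (simp add: euler_def scale_coeffs_sum)
  also have "(\<Sum>i\<in>(UNIV :: 'n set). scale_coeffs 2 a) = scale_coeffs (2 * of_nat CARD('n)) a"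
    by (rule poly_mapping_eqI) (simp add: lookup_ops)
  finally show ?thesis
    by (simp add: add.assoc)
qed

section \<open>Homogeneity\<close>

lemma homogeneous_coeffs_iff: "homogeneous_coeffs m a \<longleftrightarrow> (\<forall>\<alpha>. lookup a \<alpha> \<noteq> 0 \<longrightarrow> sum \<alpha> UNIV = m)"
  by (auto simp: homogeneous_coeffs_def in_keys_iff)

text \<open>
  Stated additively, because natural number subtraction would need side conditions.
\<close>

lemma sum_fun_upd: "sum (\<alpha>(i := k)) UNIV + \<alpha> i = sum \<alpha> UNIV + (k :: nat)"
  for \<alpha> :: "'n::finite \<Rightarrow> nat"
  by (simp add: sum.remove[of UNIV i])

lemma homogeneous_0 [simp]: "homogeneous_coeffs m 0"
  by (simp add: homogeneous_coeffs_def)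

lemma homogeneous_add:
  "homogeneous_coeffs m a \<Longrightarrow> homogeneous_coeffs m b \<Longrightarrow> homogeneous_coeffs m (a + b)"
  unfolding homogeneous_coeffs_iff lookup_add by (metis add_0)

lemma homogeneous_scale: "homogeneous_coeffs m a \<Longrightarrow> homogeneous_coeffs m (scale_coeffs c a)"
  by (auto simp: homogeneous_coeffs_iff lookup_ops)

lemma homogeneous_sum:
  "(\<And>i. i \<in> I \<Longrightarrow> homogeneous_coeffs m (f i)) \<Longrightarrow> homogeneous_coeffs m (\<Sum>i\<in>I. f i)"
  by (induction I rule: infinite_finite_induct) (auto intro: homogeneous_add)

lemma homogeneous_times_var:
  assumes "homogeneous_coeffs m a"
  shows "homogeneous_coeffs (Suc m) (times_var i a)"
  unfolding homogeneous_coeffs_iff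
proof (intro allI impI)
  fix \<alpha> :: "'a \<Rightarrow> nat" assume "lookup (times_var i a) \<alpha> \<noteq> 0"
  then have "\<alpha> i \<noteq> 0" "sum (\<alpha>(i := \<alpha> i - 1)) UNIV = m"
    using assms by (auto simp: lookup_ops homogeneous_coeffs_iff split: if_splits)
  then show "sum \<alpha> UNIV = Suc m"
    using sum_fun_upd[of \<alpha> i "\<alpha> i - 1"] by linarith
qed

lemma homogeneous_deriv_var:
  assumes "homogeneous_coeffs m a"
  shows "homogeneous_coeffs (m - 1) (deriv_var i a)"
  unfolding homogeneous_coeffs_iff
proof (intro allI impI)
  fix \<alpha> :: "'a \<Rightarrow> nat" assume "lookup (deriv_var i a) \<alpha> \<noteq> 0"
  then have "sum (\<alpha>(i := Suc (\<alpha> i))) UNIV = m"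
    using assms by (auto simp: lookup_ops homogeneous_coeffs_iff)
  then show "sum \<alpha> UNIV = m - 1"
    using sum_fun_upd[of \<alpha> i "Suc (\<alpha> i)"] by linarith
qed

lemma homogeneous_times_normsq_pow:
  assumes "homogeneous_coeffs m a"
  shows "homogeneous_coeffs (m + 2 * k) ((times_normsq ^^ k) a)"
proof (induction k)
  case (Suc k)
  have "homogeneous_coeffs (Suc (Suc (m + 2 * k))) (times_normsq ((times_normsq ^^ k) a))"
    unfolding times_normsq_def[of "(times_normsq ^^ k) a"]
    by (intro homogeneous_sum homogeneous_times_var Suc.IH)
  then show ?case by simp
qed (use assms in simp)

lemma euler_homogeneous:
  assumes "homogeneous_coeffs m a"
  shows "euler a = scale_coeffs (of_nat m) a"
proof (rule poly_mapping_eqI)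
  fix \<alpha> :: "'a \<Rightarrow> nat"
  show "lookup (euler a) \<alpha> = lookup (scale_coeffs (of_nat m) a) \<alpha>"
    using assms by (cases "lookup a \<alpha> = 0") (auto simp: lookup_euler lookup_ops homogeneous_coeffs_iff)
qed

text \<open>
  Degree \<open>0\<close> needs its own treatment because \<open>m - 1\<close> in \<open>homogeneous_deriv_var\<close> is truncated there.
\<close>

lemma deriv_var_homogeneous_0:
  assumes "homogeneous_coeffs 0 a"
  shows "deriv_var i a = 0"
proof (rule poly_mapping_eqI)
  fix \<alpha> :: "'a \<Rightarrow> nat"
  have "sum (\<alpha>(i := Suc (\<alpha> i))) UNIV \<noteq> 0"
    using sum_fun_upd[of \<alpha> i "Suc (\<alpha> i)"] by linarith
  then show "lookup (deriv_var i a) \<alpha> = lookup 0 \<alpha>"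
    using assms unfolding homogeneous_coeffs_iff lookup_ops by auto
qed

text \<open>
  The subtraction is in \<open>\<complex>\<close>, so the identity covers \<open>m = 0\<close>, where the derivative vanishes.
\<close>

lemma euler_deriv_var_homogeneous:
  assumes "homogeneous_coeffs m a"
  shows "euler (deriv_var i a) = scale_coeffs (of_nat m - 1) (deriv_var i a)"
proof (cases m)
  case 0
  then have "deriv_var i a = 0"
    using deriv_var_homogeneous_0 assms by blast
  then show ?thesis by (simp add: euler_def)
next
  case (Suc m')
  then show ?thesis
    using euler_homogeneous[OF homogeneous_deriv_var[OF assms]] by simp
qed

text \<open>
  On each homogeneous component the commutator \<open>[\<Delta>, |x|\<^sup>2] = 4E + 2n\<close> is a scalar, so the claim follows
  by induction on \<open>k\<close>.  Each application of \<open>\<Delta>\<close> thus lowers the power of \<open>|x|\<^sup>2\<close> by one, which bounds the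
  order of polyharmonicity.
\<close>

lemma laplace_times_normsq_pow_harmonic:
  fixes h :: "'n::finite coeffs"
  assumes "homogeneous_coeffs j h" and "laplace h = 0"
  shows "\<exists>c. laplace ((times_normsq ^^ Suc k) h) = scale_coeffs c ((times_normsq ^^ k) h)"
proof (induction k)
  case 0
  have "laplace (times_normsq h) = scale_coeffs (4 * of_nat j + 2 * of_nat CARD('n)) h"
    by (rule poly_mapping_eqI)
      (simp add: laplace_times_normsq assms(2) euler_homogeneous[OF assms(1)] lookup_ops algebra_simps)
  then show ?case by auto
next
  case (Suc k)
  let ?N = times_normsq
  from Suc obtain c where c: "laplace (?N ((?N ^^ k) h)) = scale_coeffs c ((?N ^^ k) h)" by auto
  have E: "euler (?N ((?N ^^ k) h)) = scale_coeffs (of_nat (j + 2 * Suc k)) (?N ((?N ^^ k) h))"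
    using euler_homogeneous[OF homogeneous_times_normsq_pow[OF assms(1), of "Suc k"]] by simp
  have "laplace ((?N ^^ Suc (Suc k)) h) =
      scale_coeffs (c + 4 * of_nat (j + 2 * Suc k) + 2 * of_nat CARD('n)) ((?N ^^ Suc k) h)"
    by (rule poly_mapping_eqI)
      (simp add: laplace_times_normsq[of "?N ((?N ^^ k) h)"] c E times_normsq_scale
        scale_coeffs.rep_eq lookup_add algebra_simps)
  then show ?case by blast
qed

lemma polyharmonic_times_normsq_pow:
  assumes "homogeneous_coeffs j h" and "laplace h = 0" and "k < p"
  shows "(laplace ^^ p) ((times_normsq ^^ k) h) = 0"
proof -
  have "(laplace ^^ Suc k) ((times_normsq ^^ k) h) = 0" for k
  proof (induction k)
    case (Suc k)
    obtain c where c: "laplace ((times_normsq ^^ Suc k) h) = scale_coeffs c ((times_normsq ^^ k) h)"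
      using laplace_times_normsq_pow_harmonic[OF assms(1,2)] by blast
    have "(laplace ^^ Suc (Suc k)) ((times_normsq ^^ Suc k) h)
        = (laplace ^^ Suc k) (laplace ((times_normsq ^^ Suc k) h))"
      by (simp only: funpow_Suc_right[of "Suc k"] o_apply)
    also have "\<dots> = 0"
      unfolding c laplace_pow_scale Suc by simp
    finally show ?case .
  qed (use assms in simp)
  moreover have "(laplace ^^ p) f = (laplace ^^ (p - Suc k)) ((laplace ^^ Suc k) f)" for f :: "'a coeffs"
    using assms(3) by (metis Suc_leI funpow_add le_add_diff_inverse2 o_apply)
  ultimately show ?thesis by simp
qed

text \<open>
  This is the algebraic reason why the numerators of the derivatives of the fundamental solution
  stay harmonic.  Since \<open>\<partial>\<^sub>i h\<close> is harmonic of degree \<open>j - 1\<close>, the Laplacian of \<open>|x|\<^sup>2 \<partial>\<^sub>i h\<close> is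
  \<open>(4(j - 1) + 2n) \<partial>\<^sub>i h\<close>, and the Laplacian of \<open>x\<^sub>i h\<close> is \<open>2 \<partial>\<^sub>i h\<close>.  The factor \<open>2 - n - 2j\<close>, which is also
  the exponent of \<open>|x|\<close> that is being differentiated, makes the two contributions cancel.
\<close>

lemma laplace_raised_harmonic:
  fixes h :: "'n::finite coeffs"
  assumes "homogeneous_coeffs j h" and "laplace h = 0"
  shows "laplace (times_normsq (deriv_var i h)
      + scale_coeffs (2 - of_nat CARD('n) - 2 * of_nat j) (times_var i h)) = 0"
  by (rule poly_mapping_eqI)
    (simp add: laplace_add laplace_scale laplace_times_var laplace_times_normsq laplace_deriv_var
      assms(2) euler_deriv_var_homogeneous[OF assms(1)] lookup_add scale_coeffs.rep_eq algebra_simps)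

section \<open>Linear functionals of the coefficients\<close>

text \<open>
  The linear functional with value \<open>\<phi> \<alpha>\<close> on the monomial \<open>x\<^sup>\<alpha>\<close>.  Evaluation at a point and the Fischer
  pairing with a fixed family are both of this form, so the reindexing of sums over multi-indices
  is done once, here.
\<close>

definition lin_ext :: "(('n \<Rightarrow> nat) \<Rightarrow> complex) \<Rightarrow> 'n::finite coeffs \<Rightarrow> complex" where
  "lin_ext \<phi> a = (\<Sum>\<alpha>\<in>keys a. lookup a \<alpha> * \<phi> \<alpha>)"

lemma lin_ext_superset:
  "finite S \<Longrightarrow> keys a \<subseteq> S \<Longrightarrow> lin_ext \<phi> a = (\<Sum>\<alpha>\<in>S. lookup a \<alpha> * \<phi> \<alpha>)"
  unfolding lin_ext_def by (rule sum.mono_neutral_left) (auto simp: in_keys_iff)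

lemma lin_ext_0 [simp]: "lin_ext \<phi> 0 = 0"
  by (simp add: lin_ext_def)

lemma lin_ext_add: "lin_ext \<phi> (a + b) = lin_ext \<phi> a + lin_ext \<phi> b"
proof -
  let ?S = "keys a \<union> keys b"
  have "keys (a + b) \<subseteq> ?S" by (rule keys_add)
  then show ?thesis
    by (simp add: lin_ext_superset[of ?S] lookup_add algebra_simps sum.distrib)
qed

lemma lin_ext_scale: "lin_ext \<phi> (scale_coeffs c a) = c * lin_ext \<phi> a"
proof -
  have "keys (scale_coeffs c a) \<subseteq> keys a" by (auto simp: in_keys_iff lookup_ops)
  then show ?thesis
    by (simp add: lin_ext_superset[of "keys a"] lookup_ops sum_distrib_left mult.assoc)
qed

lemma lin_ext_sum: "lin_ext \<phi> (\<Sum>i\<in>I. f i) = (\<Sum>i\<in>I. lin_ext \<phi> (f i))"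
  by (induction I rule: infinite_finite_induct) (auto simp: lin_ext_add)

lemma lin_ext_times_var: "lin_ext \<phi> (times_var i a) = lin_ext (\<lambda>\<alpha>. \<phi> (\<alpha>(i := Suc (\<alpha> i)))) a"
  unfolding lin_ext_def
  by (rule sum.reindex_bij_witness[of _ "\<lambda>\<alpha>. \<alpha>(i := Suc (\<alpha> i))" "\<lambda>\<alpha>. \<alpha>(i := \<alpha> i - 1)"])
    (auto simp: in_keys_iff lookup_ops split: if_splits)

text \<open>
  Where \<open>\<alpha> i = 0\<close> the truncated \<open>\<alpha> i - 1\<close> is harmless, since the factor \<open>\<alpha> i\<close> vanishes.
\<close>

lemma lin_ext_deriv_var:
  "lin_ext \<phi> (deriv_var i a) = lin_ext (\<lambda>\<alpha>. of_nat (\<alpha> i) * \<phi> (\<alpha>(i := \<alpha> i - 1))) a"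
proof -
  have "lin_ext (\<lambda>\<alpha>. of_nat (\<alpha> i) * \<phi> (\<alpha>(i := \<alpha> i - 1))) a
      = (\<Sum>\<alpha>\<in>{\<alpha> \<in> keys a. \<alpha> i \<noteq> 0}. lookup a \<alpha> * (of_nat (\<alpha> i) * \<phi> (\<alpha>(i := \<alpha> i - 1))))"
    unfolding lin_ext_def by (rule sum.mono_neutral_right) auto
  also have "\<dots> = lin_ext \<phi> (deriv_var i a)"
    unfolding lin_ext_def
    by (rule sum.reindex_bij_witness[of _ "\<lambda>\<alpha>. \<alpha>(i := Suc (\<alpha> i))" "\<lambda>\<alpha>. \<alpha>(i := \<alpha> i - 1)"])
      (auto simp: in_keys_iff lookup_ops)
  finally show ?thesis ..
qed

section \<open>The Fischer pairing\<close>

definition fischer :: "'n::finite coeffs \<Rightarrow> 'n coeffs \<Rightarrow> complex" where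
  "fischer a b = lin_ext (\<lambda>\<alpha>. (\<Prod>i\<in>UNIV. fact (\<alpha> i)) * cnj (lookup b \<alpha>)) a"

text \<open>
  The weights \<open>\<alpha>!\<close> are chosen for this adjointness: raising \<open>\<alpha>\<^sub>i\<close> by one multiplies the weight by
  \<open>\<alpha>\<^sub>i + 1\<close>, which is the factor that \<open>\<partial>\<^sub>i\<close> produces.
\<close>

lemma fischer_times_var: "fischer (times_var i a) b = fischer a (deriv_var i b)"
proof -
  have "(\<Prod>k\<in>UNIV. fact ((\<alpha>(i := Suc (\<alpha> i))) k) :: complex) = of_nat (Suc (\<alpha> i)) * (\<Prod>k\<in>UNIV. fact (\<alpha> k))"
    for \<alpha> :: "'a \<Rightarrow> nat"
    by (simp add: prod.remove[of UNIV i])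
  then show ?thesis
    by (simp add: fischer_def lin_ext_times_var lookup_ops mult_ac del: of_nat_Suc)
qed

lemma fischer_sum_right: "fischer a (\<Sum>i\<in>I. f i) = (\<Sum>i\<in>I. fischer a (f i))"
  unfolding fischer_def lin_ext_def lookup_sum cnj_sum sum_distrib_left
  by (rule sum.swap)

lemma fischer_times_normsq_pow:
  "fischer ((times_normsq ^^ k) a) b = fischer a ((laplace ^^ k) b)"
proof (induction k arbitrary: b)
  case (Suc k)
  have "fischer (times_normsq c) b = fischer c (laplace b)" for c
    by (simp add: times_normsq_def laplace_def fischer_sum_right flip: fischer_times_var)
      (simp add: fischer_def lin_ext_sum)
  then show ?case
    by (simp add: Suc) (simp flip: funpow_swap1)
qed simp

lemma fischer_definite: "fischer a a = 0 \<longleftrightarrow> a = 0"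
proof
  let ?q = "\<lambda>\<alpha>. (\<Prod>i\<in>UNIV. fact (\<alpha> i)) * (norm (lookup a \<alpha>))\<^sup>2 :: real"
  assume "fischer a a = 0"
  moreover have "fischer a a = of_real (\<Sum>\<alpha>\<in>keys a. ?q \<alpha>)"
    unfolding fischer_def lin_ext_def of_real_sum
    by (rule sum.cong) (auto simp: complex_norm_square simp del: of_real_power)
  ultimately have "complex_of_real (\<Sum>\<alpha>\<in>keys a. ?q \<alpha>) = 0"
    by (simp only:)
  then have "(\<Sum>\<alpha>\<in>keys a. ?q \<alpha>) = 0"
    by (simp only: of_real_eq_0_iff)
  moreover have "?q \<alpha> \<ge> 0" for \<alpha>
    by (intro mult_nonneg_nonneg prod_nonneg) auto
  ultimately have "?q \<alpha> = 0" if "\<alpha> \<in> keys a" for \<alpha>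
    using that sum_nonneg_eq_0_iff[of "keys a" ?q] by auto
  then have "lookup a \<alpha> = 0" if "\<alpha> \<in> keys a" for \<alpha>
    using that by simp
  then show "a = 0"
    by (intro poly_mapping_eqI) (metis in_keys_iff lookup_zero)
qed (simp add: fischer_def)

text \<open>
  By adjointness \<open>\<langle>|x|\<^sup>2\<^sup>p g, |x|\<^sup>2\<^sup>p g\<rangle> = \<langle>g, \<Delta>\<^sup>p(|x|\<^sup>2\<^sup>p g)\<rangle> = 0\<close>, and the pairing is positive definite.
\<close>

lemma polyharmonic_multiple_of_normsq_eq_0:
  assumes "(laplace ^^ p) ((times_normsq ^^ p) g) = 0"
  shows "(times_normsq ^^ p) g = 0"
proof -
  have "fischer ((times_normsq ^^ p) g) ((times_normsq ^^ p) g) = fischer g 0"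
    by (simp only: fischer_times_normsq_pow assms)
  also have "\<dots> = 0"
    by (simp add: fischer_def lin_ext_def)
  finally show ?thesis
    by (simp only: fischer_definite)
qed

section \<open>Polynomial functions\<close>

lemma cpoly_eq_lin_ext: "cpoly a z = lin_ext (\<lambda>\<alpha>. \<Prod>i\<in>UNIV. (z $ i) ^ \<alpha> i) a"
  by (simp add: cpoly_def lin_ext_def)

lemma cpoly_0 [simp]: "cpoly 0 z = 0"
  by (simp add: cpoly_def)

lemma cpoly_add: "cpoly (a + b) z = cpoly a z + cpoly b z"
  by (simp add: cpoly_eq_lin_ext lin_ext_add)

lemma cpoly_scale: "cpoly (scale_coeffs c a) z = c * cpoly a z"
  by (simp add: cpoly_eq_lin_ext lin_ext_scale)

lemma cpoly_sum: "cpoly (\<Sum>i\<in>I. f i) z = (\<Sum>i\<in>I. cpoly (f i) z)"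
  by (simp add: cpoly_eq_lin_ext lin_ext_sum)

lemma cpoly_times_var: "cpoly (times_var i a) z = z $ i * cpoly a z"
proof -
  have "(\<Prod>k\<in>UNIV. (z $ k) ^ (\<alpha>(i := Suc (\<alpha> i))) k) = z $ i * (\<Prod>k\<in>UNIV. (z $ k) ^ \<alpha> k)" for \<alpha>
    by (simp add: prod.remove[of UNIV i])
  then show ?thesis
    by (simp add: cpoly_eq_lin_ext lin_ext_times_var) (simp add: lin_ext_def sum_distrib_left mult_ac)
qed

lemma cpoly_times_normsq_pow:
  "cpoly ((times_normsq ^^ k) a) z = (\<Sum>j\<in>UNIV. (z $ j)\<^sup>2) ^ k * cpoly a z"
proof (induction k)
  case (Suc k)
  have "cpoly (times_normsq b) z = (\<Sum>j\<in>UNIV. (z $ j)\<^sup>2) * cpoly b z" for b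
    by (simp add: times_normsq_def cpoly_sum cpoly_times_var sum_distrib_right power2_eq_square mult.assoc)
  with Suc show ?case by simp
qed simp

text \<open>
  Only the factor \<open>(z\<^sub>j + t)\<close> to the power \<open>\<alpha>\<^sub>j\<close> of a monomial depends on \<open>t\<close>.
\<close>

lemma cpoly_has_partial_derivative:
  "((\<lambda>t. cpoly a (z + t *s axis j 1)) has_field_derivative cpoly (deriv_var j a) z) (at 0)"
proof -
  have "((\<lambda>t. \<Prod>i\<in>UNIV. ((z + t *s axis j 1) $ i) ^ \<alpha> i) has_field_derivative
      of_nat (\<alpha> j) * (\<Prod>i\<in>UNIV. (z $ i) ^ (\<alpha>(j := \<alpha> j - 1)) i)) (at 0)" for \<alpha>
  proof -
    let ?r = "\<Prod>i\<in>UNIV - {j}. (z $ i) ^ \<alpha> i"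
    have "(\<Prod>i\<in>UNIV. ((z + t *s axis j 1) $ i) ^ \<alpha> i) = (z $ j + t) ^ \<alpha> j * ?r" for t
      by (simp add: prod.remove[of UNIV j]) (simp add: axis_def)
    moreover have "(\<Prod>i\<in>UNIV. (z $ i) ^ (\<alpha>(j := \<alpha> j - 1)) i) = (z $ j) ^ (\<alpha> j - 1) * ?r"
      by (simp add: prod.remove[of UNIV j])
    ultimately show ?thesis
      by (auto intro!: derivative_eq_intros)
  qed
  then show ?thesis
    unfolding cpoly_eq_lin_ext lin_ext_deriv_var unfolding lin_ext_def
    by (intro DERIV_sum DERIV_cmult)
qed

lemma partial_complex_cpoly: "partial_complex j (cpoly a) = cpoly (deriv_var j a)"
  unfolding partial_complex_def using cpoly_has_partial_derivative DERIV_imp_deriv by blast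

lemma rpoly_has_partial_derivative:
  "((\<lambda>t. rpoly a (x + t *\<^sub>R axis j 1)) has_vector_derivative rpoly (deriv_var j a) x) (at 0)"
proof -
  have "of_real_vec (x + t *\<^sub>R axis j 1) = of_real_vec x + of_real t *s axis j 1" for t
    by (simp add: of_real_vec_def vec_eq_iff axis_def)
  then show ?thesis
    unfolding rpoly_def
    using has_vector_derivative_real_field[where a = 0, simplified, OF cpoly_has_partial_derivative]
    by simp
qed

lemma partial_real_rpoly: "partial_real j (rpoly a) = rpoly (deriv_var j a)"
  unfolding partial_real_def using rpoly_has_partial_derivative vector_derivative_at by blast

lemma laplacian_complex_pow_cpoly: "(laplacian_complex ^^ k) (cpoly a) = cpoly ((laplace ^^ k) a)"
proof (induction k)
  case (Suc k)
  have "laplacian_complex (cpoly a) = cpoly (laplace a)" for a :: "'a coeffs"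
    by (rule ext) (simp add: laplacian_complex_def partial_complex_cpoly laplace_def cpoly_sum)
  with Suc show ?case by simp
qed simp

lemma laplacian_real_pow_rpoly: "(laplacian_real ^^ k) (rpoly a) = rpoly ((laplace ^^ k) a)"
proof (induction k)
  case (Suc k)
  have "laplacian_real (rpoly a) = rpoly (laplace a)" for a :: "'a coeffs"
    by (rule ext)
      (simp add: laplacian_real_def partial_real_rpoly laplace_def, simp add: rpoly_def cpoly_sum)
  with Suc show ?case by simp
qed simp

lemma rpoly_add: "rpoly (a + b) x = rpoly a x + rpoly b x"
  by (simp add: rpoly_def cpoly_add)

lemma rpoly_scale: "rpoly (scale_coeffs c a) x = c * rpoly a x"
  by (simp add: rpoly_def cpoly_scale)

lemma rpoly_sum: "rpoly (\<Sum>i\<in>I. f i) x = (\<Sum>i\<in>I. rpoly (f i) x)"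
  by (simp add: rpoly_def cpoly_sum)

lemma rpoly_times_var: "rpoly (times_var i a) x = of_real (x $ i) * rpoly a x"
  by (simp add: rpoly_def cpoly_times_var of_real_vec_def)

lemma rpoly_times_normsq_pow:
  "rpoly ((times_normsq ^^ k) a) x = of_real (norm x ^ (2 * k)) * rpoly a x"
proof -
  have "(\<Sum>j\<in>UNIV. (of_real_vec x $ j)\<^sup>2) = of_real ((norm x)\<^sup>2)"
    by (simp add: of_real_vec_def norm_vec_def L2_set_def sum_nonneg)
  then show ?thesis
    by (simp add: rpoly_def cpoly_times_normsq_pow power_mult)
qed

lemma rpoly_homogeneous:
  assumes "homogeneous_coeffs m a"
  shows "rpoly a (c *\<^sub>R x) = of_real (c ^ m) * rpoly a x"
proof -
  have "(\<Prod>i\<in>UNIV. (of_real_vec (c *\<^sub>R x) $ i) ^ \<alpha> i)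
      = of_real (c ^ m) * (\<Prod>i\<in>UNIV. (of_real_vec x $ i) ^ \<alpha> i)" if "\<alpha> \<in> keys a" for \<alpha>
  proof -
    have "sum \<alpha> UNIV = m" using assms that by (simp add: homogeneous_coeffs_def)
    then show ?thesis
      by (simp add: of_real_vec_def power_mult_distrib prod.distrib flip: power_sum)
  qed
  then show ?thesis
    by (simp add: rpoly_def cpoly_def sum_distrib_left mult_ac)
qed

text \<open>
  The coefficient at \<open>\<alpha>\<close> is, up to the factor \<open>\<alpha>!\<close>, the derivative of order \<open>\<alpha>\<close> at the origin.
\<close>

lemma rpoly_eq_0_imp:
  assumes "\<And>x. rpoly a x = 0"
  shows "a = 0"
proof (rule poly_mapping_eqI)
  fix \<alpha> :: "'a \<Rightarrow> nat"
  show "lookup a \<alpha> = lookup 0 \<alpha>"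
    using assms
  proof (induction "sum \<alpha> UNIV" arbitrary: \<alpha> a)
    case 0
    have "(\<Prod>i\<in>UNIV. (0::complex) ^ \<beta> i) = (if \<beta> = (\<lambda>_. 0) then 1 else 0)" for \<beta> :: "'a \<Rightarrow> nat"
      by (auto simp: fun_eq_iff)
    then have "rpoly a 0 = (\<Sum>\<beta>\<in>keys a. if \<beta> = (\<lambda>_. 0) then lookup a \<beta> else 0)"
      unfolding rpoly_def cpoly_def of_real_vec_def by (intro sum.cong) auto
    then have "rpoly a 0 = lookup a (\<lambda>_. 0)"
      by (simp add: in_keys_iff)
    moreover have "\<alpha> = (\<lambda>_. 0)" using 0 by auto
    ultimately show ?case using 0 by simp
  next
    case (Suc s)
    then obtain i where i: "\<alpha> i \<noteq> 0" by (metis sum.neutral nat.distinct(1))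
    \<comment> \<open>Pass to the derivative in a direction in which \<open>\<alpha>\<close> is positive; this lowers \<open>|\<alpha>|\<close>.\<close>
    let ?\<beta> = "\<alpha>(i := \<alpha> i - 1)"
    have "s = sum ?\<beta> UNIV" using sum_fun_upd[of \<alpha> i "\<alpha> i - 1"] i Suc by linarith
    moreover have "rpoly (deriv_var i a) x = 0" for x
    proof -
      have "rpoly a = (\<lambda>_. 0)" using Suc.prems by auto
      then show ?thesis
        unfolding partial_real_rpoly[symmetric] partial_real_def by simp
    qed
    ultimately have "lookup (deriv_var i a) ?\<beta> = 0" using Suc.hyps(1) by simp
    then show ?case using i by (simp add: lookup_ops del: of_nat_Suc)
  qed
qed

text \<open>
  Agreement off the origin is enough: the difference times a coordinate vanishes everywhere, and
  multiplication by a coordinate is injective on coefficients.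
\<close>

lemma rpoly_eqI:
  assumes "\<And>x. x \<noteq> 0 \<Longrightarrow> rpoly a x = rpoly b x"
  shows "a = b"
proof -
  obtain i :: 'a where True by simp
  define c where "c = a + scale_coeffs (-1) b"
  have "rpoly (times_var i c) x = 0" for x
    using assms[of x] by (cases "x = 0") (auto simp: c_def rpoly_times_var rpoly_add rpoly_scale)
  then have "times_var i c = 0" by (rule rpoly_eq_0_imp)
  have "c = 0"
  proof (rule poly_mapping_eqI)
    fix \<alpha>
    have "lookup (times_var i c) (\<alpha>(i := Suc (\<alpha> i))) = lookup c \<alpha>"
      by (simp add: lookup_ops)
    with \<open>times_var i c = 0\<close> show "lookup c \<alpha> = lookup 0 \<alpha>" by simp
  qed
  then have "lookup a \<alpha> = lookup b \<alpha>" for \<alpha>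
    by (metis c_def add_eq_0_iff lookup_add lookup_zero minus_minus mult_minus1 scale_coeffs.rep_eq)
  then show ?thesis by (rule poly_mapping_eqI)
qed

lemma inj_rpoly: "inj rpoly"
  by (rule injI) (metis rpoly_eqI)

lemma inj_cpoly: "inj cpoly"
  by (rule injI) (metis rpoly_eqI rpoly_def)

lemma coeffs_of_rpoly: "coeffs_of (rpoly a) = a"
  unfolding coeffs_of_def using inj_rpoly by (auto dest: injD)

lemma identify_poly_eqI:
  assumes "\<And>x. x \<noteq> 0 \<Longrightarrow> f x = rpoly a x"
  shows "identify_poly f = rpoly a"
  unfolding identify_poly_def
proof (rule the_equality)
  fix q assume "q \<in> range rpoly \<and> (\<forall>x. x \<noteq> 0 \<longrightarrow> q x = f x)"
  then obtain b where b: "q = rpoly b" "\<And>x. x \<noteq> 0 \<Longrightarrow> rpoly b x = rpoly a x"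
    using assms by auto
  then show "q = rpoly a" using rpoly_eqI by blast
qed (use assms in auto)

section \<open>Derivatives of the fundamental solution\<close>

text \<open>
  The functions that arise from the fundamental solution by \<open>j\<close> differentiations: on \<open>\<real>\<^sup>n - {0}\<close>, these
  are the Kelvin transforms of harmonic homogeneous polynomials of degree \<open>j\<close>.  Nothing is said about
  the value at \<open>0\<close>, where derivatives taken as in \<open>partial_real\<close> carry no information.
\<close>

definition harmonic_times_norm_power :: "nat \<Rightarrow> (real^'n::finite \<Rightarrow> complex) \<Rightarrow> bool" where
  "harmonic_times_norm_power j f \<longleftrightarrow> (\<exists>h. homogeneous_coeffs j h \<and> laplace h = 0 \<and>
     (\<forall>x. x \<noteq> 0 \<longrightarrow> f x = rpoly h x * of_real (norm x powi (2 - int CARD('n) - 2 * int j))))"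

lemma norm_has_partial_derivative:
  fixes x :: "real^'n::finite"
  assumes "x \<noteq> 0"
  shows "((\<lambda>t. norm (x + t *\<^sub>R axis i 1)) has_field_derivative x $ i / norm x) (at 0)"
proof -
  have 1: "((\<lambda>t. x + t *\<^sub>R axis i 1) has_derivative (\<lambda>t. t *\<^sub>R axis i 1)) (at 0)"
    by (auto intro!: derivative_eq_intros)
  have 2: "(norm has_derivative (\<lambda>h. inner h (sgn x))) (at (x + 0 *\<^sub>R axis i 1))"
    using has_derivative_norm[OF assms] by simp
  have 3: "(\<lambda>t. inner (t *\<^sub>R axis i 1) (sgn x)) = (*) (x $ i / norm x)"
    by (rule ext) (simp add: sgn_div_norm inner_axis' divide_inverse)
  show ?thesis
    unfolding has_field_derivative_def 3[symmetric] by (rule has_derivative_compose[OF 1 2])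
qed

text \<open>
  A partial derivative at \<open>x \<noteq> 0\<close> sees only values near \<open>x\<close>, so a formula valid off the origin may be
  differentiated.
\<close>

lemma partial_real_eqI_off_0:
  fixes x :: "real^'n::finite"
  assumes "x \<noteq> 0" and "\<And>y. y \<noteq> 0 \<Longrightarrow> f y = g y"
    and "((\<lambda>t. g (x + t *\<^sub>R axis i 1)) has_vector_derivative D) (at 0)"
  shows "partial_real i f x = D"
  unfolding partial_real_def
proof (rule vector_derivative_at, rule has_vector_derivative_transform_within_open[OF assms(3)])
  show "open {t. x + t *\<^sub>R axis i 1 \<noteq> 0}"
    by (intro open_Collect_neq continuous_intros)
  show "0 \<in> {t. x + t *\<^sub>R axis i 1 \<noteq> 0}"
    using assms(1) by simp
  show "g (x + t *\<^sub>R axis i 1) = f (x + t *\<^sub>R axis i 1)" if "t \<in> {t. x + t *\<^sub>R axis i 1 \<noteq> 0}" for t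
    using assms(2) that by simp
qed

text \<open>
  The product rule gives \<open>\<partial>\<^sub>i (h |x|\<^sup>s) = (|x|\<^sup>2 \<partial>\<^sub>i h + s x\<^sub>i h) |x|\<^sup>s\<^sup>-\<^sup>2\<close> with \<open>s = 2 - n - 2j\<close>, and the numerator is
  harmonic by \<open>laplace_raised_harmonic\<close>.
\<close>

lemma partial_harmonic_times_norm_power:
  fixes f :: "real^'n::finite \<Rightarrow> complex"
  assumes "harmonic_times_norm_power j f"
  shows "harmonic_times_norm_power (Suc j) (partial_real i f)"
proof -
  define s where "s = 2 - int CARD('n) - 2 * int j"
  from assms obtain h where h: "homogeneous_coeffs j h" "laplace h = 0"
    and f: "\<And>x. x \<noteq> 0 \<Longrightarrow> f x = rpoly h x * of_real (norm x powi s)"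
    unfolding harmonic_times_norm_power_def s_def by blast
  define h' where "h' = times_normsq (deriv_var i h) + scale_coeffs (of_int s) (times_var i h)"
  have "partial_real i f x = rpoly h' x * of_real (norm x powi (s - 2))" if x: "x \<noteq> 0" for x
  proof (rule partial_real_eqI_off_0[OF x f])
    have n: "norm x \<noteq> 0" using x by simp
    have "((\<lambda>t. norm (x + t *\<^sub>R axis i 1) powi s) has_field_derivative
        of_int s * norm x powi (s - 1) * (x $ i / norm x)) (at 0)"
      using DERIV_power_int[OF norm_has_partial_derivative[OF x, of i], of s] n by simp
    from has_vector_derivative_mult[OF rpoly_has_partial_derivative[of h x i] has_vector_derivative_of_real[OF this]]
    show "((\<lambda>t. rpoly h (x + t *\<^sub>R axis i 1) * of_real (norm (x + t *\<^sub>R axis i 1) powi s))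
        has_vector_derivative rpoly h' x * of_real (norm x powi (s - 2))) (at 0)"
    proof (rule has_vector_derivative_eq_rhs)
      have "norm x powi s = (norm x)\<^sup>2 * norm x powi (s - 2)"
        using n by (simp add: power_int_diff power2_eq_square)
      moreover have "norm x powi (s - 1) = norm x * norm x powi (s - 2)"
        using n by (simp add: power_int_diff power2_eq_square)
      moreover have "rpoly (times_normsq (deriv_var i h)) x = of_real ((norm x)\<^sup>2) * rpoly (deriv_var i h) x"
        using rpoly_times_normsq_pow[of 1] by simp
      ultimately show "rpoly h (x + 0 *\<^sub>R axis i 1) * of_real (of_int s * norm x powi (s - 1) * (x $ i / norm x)) +
          rpoly (deriv_var i h) x * of_real (norm (x + 0 *\<^sub>R axis i 1) powi s)
          = rpoly h' x * of_real (norm x powi (s - 2))"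
        using n by (simp add: h'_def rpoly_add rpoly_scale rpoly_times_var algebra_simps)
    qed
  qed
  moreover have "homogeneous_coeffs (Suc j) h'"
  proof (cases j)
    case 0
    then have "deriv_var i h = 0"
      using deriv_var_homogeneous_0 h(1) by blast
    then show ?thesis
      unfolding h'_def by (auto intro!: homogeneous_add homogeneous_scale homogeneous_times_var h)
  next
    case (Suc j')
    then have "homogeneous_coeffs (Suc j) (times_normsq (deriv_var i h))"
      using homogeneous_times_normsq_pow[OF homogeneous_deriv_var[OF h(1)], of 1 i] by simp
    then show ?thesis
      unfolding h'_def by (auto intro!: homogeneous_add homogeneous_scale homogeneous_times_var h)
  qed
  moreover have "laplace h' = 0"
    using laplace_raised_harmonic[OF h, of i] by (simp add: h'_def s_def)
  moreover have "s - 2 = 2 - int CARD('n) - 2 * int (Suc j)"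
    by (simp add: s_def)
  ultimately show ?thesis
    unfolding harmonic_times_norm_power_def by metis
qed

lemma harmonic_times_norm_power_riesz:
  "harmonic_times_norm_power 0 (\<lambda>y :: real^'n::finite. of_real (norm y powi (2 - int CARD('n))))"
proof -
  let ?h = "Poly_Mapping.single (\<lambda>_. 0) 1 :: 'n coeffs"
  have "rpoly ?h x = 1" for x
    by (simp add: rpoly_def cpoly_def)
  moreover have "homogeneous_coeffs 0 ?h"
    by (simp add: homogeneous_coeffs_def)
  moreover have "deriv_var i ?h = 0" for i
    by (rule poly_mapping_eqI) (auto simp: lookup_ops lookup_single when_def fun_eq_iff dest!: spec[of _ i])
  then have "laplace ?h = 0" by (simp add: laplace_def)
  ultimately show ?thesis
    unfolding harmonic_times_norm_power_def by (intro exI[of _ ?h]) simp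
qed

text \<open>
  The logarithm itself is not of the required form, but its first derivatives \<open>x\<^sub>i / |x|\<^sup>2\<close> are, with
  \<open>h = x\<^sub>i\<close> and the exponent \<open>2 - n - 2 = -2\<close>.
\<close>

lemma harmonic_times_norm_power_partial_log:
  assumes "CARD('n::finite) = 2"
  shows "harmonic_times_norm_power 1 (partial_real i (\<lambda>y :: real^'n. of_real (ln (norm y))))"
proof -
  let ?h = "times_var i (Poly_Mapping.single (\<lambda>_. 0) 1) :: 'n coeffs"
  let ?L = "\<lambda>y :: real^'n. complex_of_real (ln (norm y))"
  have 1: "rpoly (Poly_Mapping.single (\<lambda>_. 0) 1) x = 1" for x :: "real^'n"
    by (simp add: rpoly_def cpoly_def)
  have "partial_real i ?L x = rpoly ?h x * of_real (norm x powi (-2))" if "x \<noteq> 0" for x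
  proof (rule partial_real_eqI_off_0[OF that refl])
    have "((\<lambda>t. ln (norm (x + t *\<^sub>R axis i 1))) has_field_derivative inverse (norm x) * (x $ i / norm x)) (at 0)"
      using DERIV_chain2[OF DERIV_ln norm_has_partial_derivative[OF that, of i]] that by simp
    then have "((\<lambda>t. ?L (x + t *\<^sub>R axis i 1)) has_vector_derivative
        of_real (inverse (norm x) * (x $ i / norm x))) (at 0)"
      by (rule has_vector_derivative_of_real)
    then show "((\<lambda>t. ?L (x + t *\<^sub>R axis i 1)) has_vector_derivative
        rpoly ?h x * of_real (norm x powi (-2))) (at 0)"
      using that
      by (simp add: 1 rpoly_times_var power_int_minus power2_eq_square divide_simps)
  qed
  moreover have "homogeneous_coeffs 1 ?h"
    unfolding One_nat_def by (intro homogeneous_times_var) (simp add: homogeneous_coeffs_def)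
  moreover have "deriv_var k (Poly_Mapping.single (\<lambda>_. 0) 1 :: 'n coeffs) = 0" for k
    by (rule poly_mapping_eqI) (auto simp: lookup_ops lookup_single when_def fun_eq_iff dest!: spec[of _ k])
  then have "laplace ?h = 0" by (simp add: laplace_times_var) (simp add: laplace_def)
  ultimately show ?thesis
    unfolding harmonic_times_norm_power_def using assms by (intro exI[of _ ?h]) simp
qed

text \<open>
  Reduces \<open>D\<^sup>\<alpha>\<close>, an iteration over an arbitrary enumeration of the coordinates, to single partial
  derivatives.  The predicate sees the order reached so far, because the degrees of the polynomials
  involved depend on it.
\<close>

lemma multi_deriv_induct:
  fixes P :: "nat \<Rightarrow> (real^'n::finite \<Rightarrow> complex) \<Rightarrow> bool"
  assumes "P 0 f" and step: "\<And>j g i. P j g \<Longrightarrow> P (Suc j) (partial_real i g)"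
  shows "P (sum \<alpha> UNIV) (multi_deriv \<alpha> f)"
proof -
  have pow: "P (k + j) ((partial_real i ^^ k) g)" if "P j g" for j k i g
    using that by (induction k) (auto intro: step)
  have "P (\<Sum>j\<leftarrow>js. \<alpha> j) (foldr (\<lambda>j. partial_real j ^^ \<alpha> j) js f)" for js
    using assms(1) by (induction js) (auto intro: pow)
  moreover have "distinct (coords :: 'n list) \<and> set (coords :: 'n list) = UNIV"
    unfolding coords_def by (rule someI_ex) (use finite_distinct_list[of "UNIV :: 'n set"] in auto)
  then have "(\<Sum>j\<leftarrow>coords. \<alpha> j) = sum \<alpha> UNIV"
    using sum_list_distinct_conv_sum_set[of coords \<alpha>] by simp
  ultimately show ?thesis
    unfolding multi_deriv_def by metis
qed

text \<open>
  The exceptional behaviour at order \<open>0\<close> is built into the predicate used for the induction.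
\<close>

lemma multi_deriv_log:
  assumes "CARD('n::finite) = 2" and "sum \<alpha> UNIV > 0"
  shows "harmonic_times_norm_power (sum \<alpha> UNIV) (multi_deriv \<alpha> (\<lambda>y :: real^'n. of_real (ln (norm y))))"
proof -
  let ?L = "\<lambda>y :: real^'n. complex_of_real (ln (norm y))"
  have "if sum \<alpha> UNIV = 0 then multi_deriv \<alpha> ?L = ?L
      else harmonic_times_norm_power (sum \<alpha> UNIV) (multi_deriv \<alpha> ?L)"
    using harmonic_times_norm_power_partial_log[OF assms(1)]
    by (intro multi_deriv_induct[where P = "\<lambda>j g. if j = 0 then g = ?L else harmonic_times_norm_power j g"])
      (auto simp: partial_harmonic_times_norm_power split: if_splits)
  with assms(2) show ?thesis by (metis less_irrefl)
qed

text \<open>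
  By linearity \<open>w(D) f\<close> is \<open>h |x|\<^sup>s\<close> with \<open>h\<close> harmonic of degree \<open>j\<close> and \<open>s = 2 - n - 2j\<close>.  At \<open>x / |x|\<^sup>2\<close>, a
  point of norm \<open>1 / |x|\<close>, this is \<open>h(x)\<close> times \<open>|x|\<close> to the power \<open>-2j - s = n - 2\<close>, which cancels the
  factor in front of the Kelvin transform.
\<close>

lemma kelvin_poly_deriv:
  fixes f :: "real^'n::finite \<Rightarrow> complex"
  assumes "homogeneous_coeffs j w"
    and f: "\<And>\<alpha>. sum \<alpha> UNIV = j \<Longrightarrow> harmonic_times_norm_power j (multi_deriv \<alpha> f)"
  shows "\<exists>h. homogeneous_coeffs j h \<and> laplace h = 0 \<and>
    (\<forall>x. x \<noteq> 0 \<longrightarrow> kelvin (poly_deriv (rpoly w) f) x = rpoly h x)"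
proof -
  define s where "s = 2 - int CARD('n) - 2 * int j"
  \<comment> \<open>Choose the harmonic numerator for each monomial of \<open>w\<close>.\<close>
  have "\<forall>\<alpha>\<in>keys w. \<exists>h. homogeneous_coeffs j h \<and> laplace h = 0 \<and>
      (\<forall>x. x \<noteq> 0 \<longrightarrow> multi_deriv \<alpha> f x = rpoly h x * of_real (norm x powi s))"
    using f assms(1) unfolding homogeneous_coeffs_def harmonic_times_norm_power_def s_def by blast
  then obtain H where H: "\<And>\<alpha>. \<alpha> \<in> keys w \<Longrightarrow> homogeneous_coeffs j (H \<alpha>)"
      "\<And>\<alpha>. \<alpha> \<in> keys w \<Longrightarrow> laplace (H \<alpha>) = 0"
      "\<And>\<alpha> x. \<alpha> \<in> keys w \<Longrightarrow> x \<noteq> 0 \<Longrightarrow> multi_deriv \<alpha> f x = rpoly (H \<alpha>) x * of_real (norm x powi s)"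
    by metis
  define h where "h = (\<Sum>\<alpha>\<in>keys w. scale_coeffs (lookup w \<alpha>) (H \<alpha>))"
  have hom: "homogeneous_coeffs j h"
    unfolding h_def by (intro homogeneous_sum homogeneous_scale H)
  have D: "poly_deriv (rpoly w) f y = rpoly h y * of_real (norm y powi s)" if "y \<noteq> 0" for y
    using that by (simp add: poly_deriv_def coeffs_of_rpoly h_def rpoly_sum rpoly_scale H sum_distrib_right mult.assoc)
  have "kelvin (poly_deriv (rpoly w) f) x = rpoly h x" if x: "x \<noteq> 0" for x
  proof -
    define r where "r = norm x"
    have r: "r > 0" using x by (simp add: r_def)
    have "norm (x /\<^sub>R r\<^sup>2) = inverse r"
      using r by (simp add: r_def power2_eq_square)
    moreover have "rpoly h (x /\<^sub>R r\<^sup>2) = of_real (inverse r ^ (2 * j)) * rpoly h x"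
      using rpoly_homogeneous[OF hom, of "inverse (r\<^sup>2)" x] by (simp add: power_mult power_inverse)
    moreover have "r powi (2 - int CARD('n)) * (inverse r ^ (2 * j) * inverse r powi s) = 1"
    proof -
      have "inverse r ^ (2 * j) = r powi (- 2 * int j)"
        using r power_int_of_nat[of r "2 * j"] by (simp add: power_int_minus power_inverse)
      moreover have "inverse r powi s = r powi (- s)"
        by (simp add: power_int_inverse power_int_minus)
      ultimately show ?thesis
        using r by (simp add: s_def flip: power_int_add)
    qed
    then have "of_real (r powi (2 - int CARD('n))) * (of_real (inverse r ^ (2 * j)) * of_real (inverse r powi s)) = (1 :: complex)"
      by (metis of_real_1 of_real_mult)
    ultimately show ?thesis
      using x D[of "x /\<^sub>R r\<^sup>2"] r by (simp add: kelvin_def r_def[symmetric] del: of_real_power of_real_power_int of_real_inverse)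
  qed
  moreover have "laplace h = 0"
    by (simp add: h_def laplace_sum laplace_scale H)
  ultimately show ?thesis using hom by blast
qed

section \<open>The summands of the expansion\<close>

text \<open>
  The polynomial \<open>h\<close> is a scalar multiple of the Kelvin transform of \<open>w(D) f\<close>.  The special summand
  \<open>2k = m\<close> in dimension two fits in with \<open>h = w\<close>, a constant.
\<close>

lemma kelvin_term_rpoly:
  fixes w :: "'n::finite coeffs"
  assumes n: "CARD('n) \<ge> 2" and km: "2 * k \<le> m" and w: "homogeneous_coeffs (m - 2 * k) w"
  shows "\<exists>h. homogeneous_coeffs (m - 2 * k) h \<and> laplace h = 0 \<and>
    (\<forall>x. x \<noteq> 0 \<longrightarrow> kelvin_term m k (rpoly w) x = rpoly ((times_normsq ^^ k) h) x)"
proof -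
  let ?goal = "\<lambda>h. homogeneous_coeffs (m - 2 * k) h \<and> laplace h = 0 \<and>
    (\<forall>x. x \<noteq> 0 \<longrightarrow> kelvin_term m k (rpoly w) x = rpoly ((times_normsq ^^ k) h) x)"
  consider (riesz) "CARD('n) > 2" | (const) "CARD('n) = 2" "2 * k = m" | (log) "CARD('n) = 2" "2 * k < m"
    using n km by linarith
  then show ?thesis
  proof cases
    case riesz
    let ?f = "\<lambda>y :: real^'n. complex_of_real (norm y powi (2 - int CARD('n)))"
    have "harmonic_times_norm_power (sum \<alpha> UNIV) (multi_deriv \<alpha> ?f)" for \<alpha>
      by (rule multi_deriv_induct[OF harmonic_times_norm_power_riesz partial_harmonic_times_norm_power])
    then obtain h where h: "homogeneous_coeffs (m - 2 * k) h" "laplace h = 0"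
        "\<And>x. x \<noteq> 0 \<Longrightarrow> kelvin (poly_deriv (rpoly w) ?f) x = rpoly h x"
      using kelvin_poly_deriv[OF w, of ?f] by metis
    then have "?goal (scale_coeffs (1 / of_real (c_const CARD('n) (m - 2 * k))) h)"
      using riesz
      by (simp add: homogeneous_scale laplace_scale kelvin_term_def rpoly_times_normsq_pow rpoly_scale)
    then show ?thesis by blast
  next
    case const
    then have "homogeneous_coeffs 0 w" using w by simp
    then have "laplace w = 0" by (simp add: laplace_def deriv_var_homogeneous_0)
    then have "?goal w"
      using const w by (simp add: kelvin_term_def rpoly_times_normsq_pow)
    then show ?thesis by blast
  next
    case log
    let ?f = "\<lambda>y :: real^'n. complex_of_real (ln (norm y))"
    have "harmonic_times_norm_power (m - 2 * k) (multi_deriv \<alpha> ?f)" if "sum \<alpha> UNIV = m - 2 * k" for \<alpha>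
      using multi_deriv_log[of \<alpha>] log that by simp
    then obtain h where h: "homogeneous_coeffs (m - 2 * k) h" "laplace h = 0"
        "\<And>x. x \<noteq> 0 \<Longrightarrow> kelvin (poly_deriv (rpoly w) ?f) x = rpoly h x"
      using kelvin_poly_deriv[OF w, of ?f] by metis
    then have "?goal (scale_coeffs (1 / of_real (c_tilde (m - 2 * k))) h)"
      using log
      by (simp add: homogeneous_scale laplace_scale kelvin_term_def rpoly_times_normsq_pow rpoly_scale)
    then show ?thesis by blast
  qed
qed

lemma assoc_poly_rpoly:
  assumes "homogeneous_coeffs m a"
  shows "\<exists>w. homogeneous_coeffs (m - 2 * k) w \<and> assoc_poly d m k (rpoly a) = rpoly w"
proof (cases "k = 0")
  case False
  have D: "\<exists>w. homogeneous_coeffs (m - sum \<alpha> UNIV) w \<and> multi_deriv \<alpha> (rpoly a) = rpoly w" for \<alpha>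
  proof (rule multi_deriv_induct[where P = "\<lambda>j g. \<exists>w. homogeneous_coeffs (m - j) w \<and> g = rpoly w"])
    show "\<exists>w. homogeneous_coeffs (m - 0) w \<and> rpoly a = rpoly w" using assms by auto
    show "\<exists>w. homogeneous_coeffs (m - Suc j) w \<and> partial_real i g = rpoly w"
      if "\<exists>w. homogeneous_coeffs (m - j) w \<and> g = rpoly w" for j g i
      using that homogeneous_deriv_var[of "m - j"] by (auto simp: partial_real_rpoly) blast
  qed
  then obtain W where W: "\<And>\<alpha>. homogeneous_coeffs (m - sum \<alpha> UNIV) (W \<alpha>)"
      "\<And>\<alpha>. multi_deriv \<alpha> (rpoly a) = rpoly (W \<alpha>)"
    by metis
  let ?w = "\<Sum>\<kappa> | sum \<kappa> UNIV = k. scale_coeffs (d m k \<kappa>) (W (\<lambda>i. 2 * \<kappa> i))"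
  have "homogeneous_coeffs (m - 2 * k) (W (\<lambda>i. 2 * \<kappa> i))" if "sum \<kappa> UNIV = k" for \<kappa>
    using W(1)[of "\<lambda>i. 2 * \<kappa> i"] that by (simp flip: sum_distrib_left)
  then have "homogeneous_coeffs (m - 2 * k) ?w"
    by (intro homogeneous_sum homogeneous_scale) auto
  moreover have "assoc_poly d m k (rpoly a) = rpoly ?w"
    using False by (simp add: assoc_poly_def fun_eq_iff W rpoly_sum rpoly_scale)
  ultimately show ?thesis by blast
qed (use assms in \<open>auto simp: assoc_poly_def\<close>)

text \<open>
  Take \<open>|x|\<^sup>2\<^sup>k h\<^sub>k\<close> for the summands of the expansion of the polynomial with coefficients \<open>a\<close>.  The
  partial sum over \<open>k < p\<close> is \<open>t\<close>, and the rest is divisible by \<open>|x|\<^sup>2\<^sup>p\<close> with quotient \<open>b\<close>.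
\<close>

lemma Q_map_rpoly:
  fixes d :: "nat \<Rightarrow> nat \<Rightarrow> ('n::finite \<Rightarrow> nat) \<Rightarrow> complex"
  assumes n: "CARD('n) \<ge> 2" and pm: "2 * p \<le> m" and d: "representing_constants m d"
    and a: "homogeneous_coeffs m a"
  shows "\<exists>t b. Q_map d p m (rpoly a) = rpoly t \<and> (\<forall>x. x \<noteq> 0 \<longrightarrow> Q_formula d p m (rpoly a) x = rpoly t x) \<and>
    homogeneous_coeffs m t \<and> (laplace ^^ p) t = 0 \<and>
    homogeneous_coeffs (m - 2 * p) b \<and> a = t + (times_normsq ^^ p) b"
proof -
  have "\<exists>h. homogeneous_coeffs (m - 2 * k) h \<and> laplace h = 0 \<and>
      (\<forall>x. x \<noteq> 0 \<longrightarrow> kelvin_term m k (assoc_poly d m k (rpoly a)) x = rpoly ((times_normsq ^^ k) h) x)"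
    if "k \<le> m div 2" for k
  proof -
    obtain w where "homogeneous_coeffs (m - 2 * k) w" "assoc_poly d m k (rpoly a) = rpoly w"
      using assoc_poly_rpoly[OF a] by blast
    with kelvin_term_rpoly[OF n, of k m w] that show ?thesis by simp
  qed
  then obtain H where H: "\<And>k. k \<le> m div 2 \<Longrightarrow> homogeneous_coeffs (m - 2 * k) (H k)"
      "\<And>k. k \<le> m div 2 \<Longrightarrow> laplace (H k) = 0"
      "\<And>k x. k \<le> m div 2 \<Longrightarrow> x \<noteq> 0 \<Longrightarrow>
        kelvin_term m k (assoc_poly d m k (rpoly a)) x = rpoly ((times_normsq ^^ k) (H k)) x"
    by metis
  define t where "t = (\<Sum>k<p. (times_normsq ^^ k) (H k))"
  define b where "b = (\<Sum>k\<in>{p..m div 2}. (times_normsq ^^ (k - p)) (H k))"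
  have Qf: "Q_formula d p m (rpoly a) x = rpoly t x" if "x \<noteq> 0" for x
    unfolding Q_formula_def t_def rpoly_sum using that pm by (intro sum.cong H) auto
  have "homogeneous_coeffs m ((times_normsq ^^ k) (H k))" if "k < p" for k
    using homogeneous_times_normsq_pow[OF H(1), of k k] that pm by simp
  then have t: "homogeneous_coeffs m t"
    unfolding t_def by (intro homogeneous_sum) auto
  have "(laplace ^^ p) ((times_normsq ^^ k) (H k)) = 0" if "k < p" for k
    by (rule polyharmonic_times_normsq_pow[OF H(1,2)]) (use that pm in auto)
  then have Lt: "(laplace ^^ p) t = 0"
    unfolding t_def laplace_pow_sum by (intro sum.neutral) auto
  have "homogeneous_coeffs (m - 2 * p) ((times_normsq ^^ (k - p)) (H k))" if "k \<in> {p..m div 2}" for k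
  proof -
    have "m - 2 * k + 2 * (k - p) = m - 2 * p" using that by auto
    then show ?thesis
      using homogeneous_times_normsq_pow[OF H(1), of k "k - p"] that by auto
  qed
  then have b: "homogeneous_coeffs (m - 2 * p) b"
    unfolding b_def by (intro homogeneous_sum)
  have "a = t + (times_normsq ^^ p) b"
  proof (rule rpoly_eqI)
    fix x :: "real^'n" assume x: "x \<noteq> 0"
    have "(times_normsq ^^ p) ((times_normsq ^^ (k - p)) (H k)) = (times_normsq ^^ k) (H k)"
      if "k \<in> {p..m div 2}" for k
    proof -
      have "(times_normsq ^^ (p + (k - p))) (H k) = (times_normsq ^^ p) ((times_normsq ^^ (k - p)) (H k))"
        by (simp only: funpow_add o_apply)
      then show ?thesis using that by simp
    qed
    then have "t + (times_normsq ^^ p) b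
        = (\<Sum>k<p. (times_normsq ^^ k) (H k)) + (\<Sum>k\<in>{p..m div 2}. (times_normsq ^^ k) (H k))"
      by (simp add: t_def b_def times_normsq_pow_sum)
    also have "\<dots> = (\<Sum>k\<in>{..<p} \<union> {p..m div 2}. (times_normsq ^^ k) (H k))"
      by (rule sum.union_disjoint[symmetric]) auto
    also have "{..<p} \<union> {p..m div 2} = {..m div 2}"
      using pm by auto
    finally have "rpoly (t + (times_normsq ^^ p) b) x = (\<Sum>k\<le>m div 2. rpoly ((times_normsq ^^ k) (H k)) x)"
      by (simp add: rpoly_sum)
    also have "\<dots> = (\<Sum>k\<le>m div 2. kelvin_term m k (assoc_poly d m k (rpoly a)) x)"
      using x by (intro sum.cong) (auto simp: H)
    also have "\<dots> = rpoly a x"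
      using d x a unfolding representing_constants_def hom_polys_real_def by auto
    finally show "rpoly a x = rpoly (t + (times_normsq ^^ p) b) x" ..
  qed
  moreover have "Q_map d p m (rpoly a) = rpoly t"
    unfolding Q_map_def by (rule identify_poly_eqI) (rule Qf)
  ultimately show ?thesis
    using Qf t Lt b by blast
qed

section \<open>The canonical projections\<close>

text \<open>
  The common core of the real and the complex statement: the map \<open>ev\<close> stands for \<open>rpoly\<close> or \<open>cpoly\<close>.
  Existence of the decomposition is the hypothesis on \<open>P\<close>; uniqueness holds because the difference of
  two decompositions is a polyharmonic multiple of \<open>|x|\<^sup>2\<^sup>p\<close>.
\<close>

lemma is_projection_along_coeffs:
  fixes ev :: "'n::finite coeffs \<Rightarrow> 'x \<Rightarrow> complex"
  assumes inj: "inj ev" and ev_add: "\<And>a b. ev (a + b) = (\<lambda>x. ev a x + ev b x)"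
    and pm: "2 * p \<le> m"
    and P: "\<And>a. homogeneous_coeffs m a \<Longrightarrow> \<exists>t b. P (ev a) = ev t \<and>
      homogeneous_coeffs m t \<and> (laplace ^^ p) t = 0 \<and>
      homogeneous_coeffs (m - 2 * p) b \<and> a = t + (times_normsq ^^ p) b"
  shows "is_projection_along {ev a | a. homogeneous_coeffs m a}
    {ev a | a. homogeneous_coeffs m a \<and> (laplace ^^ p) a = 0}
    {ev ((times_normsq ^^ p) b) | b. homogeneous_coeffs (m - 2 * p) b} P"
    (is "is_projection_along ?V ?A ?B P")
  unfolding is_projection_along_def
proof (intro conjI ballI)
  fix f g assume "f \<in> ?A" "g \<in> ?B"
  then obtain a b where "f = ev a" "homogeneous_coeffs m a"
      "g = ev ((times_normsq ^^ p) b)" "homogeneous_coeffs (m - 2 * p) b"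
    by blast
  moreover from this have "homogeneous_coeffs m (a + (times_normsq ^^ p) b)"
    using homogeneous_times_normsq_pow[of "m - 2 * p" b p] pm by (intro homogeneous_add) auto
  ultimately show "(\<lambda>x. f x + g x) \<in> ?V"
    by (auto simp flip: ev_add)
next
  fix v assume "v \<in> ?V"
  then obtain a where a: "v = ev a" "homogeneous_coeffs m a" by blast
  obtain t b where tb: "P (ev a) = ev t" "homogeneous_coeffs m t" "(laplace ^^ p) t = 0"
      "homogeneous_coeffs (m - 2 * p) b" "a = t + (times_normsq ^^ p) b"
    using P[OF a(2)] by blast
  have v: "v = (\<lambda>x. ev t x + ev ((times_normsq ^^ p) b) x)"
    unfolding a(1) by (subst tb(5)) (rule ev_add)
  have Pv: "P v = ev t" unfolding a(1) by (rule tb(1))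
  show "P v \<in> ?A" unfolding Pv using tb(2,3) by blast
  show "\<exists>g\<in>?B. v = (\<lambda>x. P v x + g x)" unfolding Pv using v tb(4) by blast
  show "\<exists>!fg. fst fg \<in> ?A \<and> snd fg \<in> ?B \<and> v = (\<lambda>x. fst fg x + snd fg x)"
  proof (rule ex1I[of _ "(ev t, ev ((times_normsq ^^ p) b))"])
    show "fst (ev t, ev ((times_normsq ^^ p) b)) \<in> ?A \<and> snd (ev t, ev ((times_normsq ^^ p) b)) \<in> ?B \<and>
        v = (\<lambda>x. fst (ev t, ev ((times_normsq ^^ p) b)) x + snd (ev t, ev ((times_normsq ^^ p) b)) x)"
      unfolding fst_conv snd_conv using v tb(2-4) by blast
  next
    fix fg assume fg: "fst fg \<in> ?A \<and> snd fg \<in> ?B \<and> v = (\<lambda>x. fst fg x + snd fg x)"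
    then obtain t' b' where t'b': "fst fg = ev t'" "(laplace ^^ p) t' = 0" "snd fg = ev ((times_normsq ^^ p) b')"
      by blast
    then have "ev a = ev (t' + (times_normsq ^^ p) b')"
      using fg a(1) ev_add by metis
    then have eq: "t + (times_normsq ^^ p) b = t' + (times_normsq ^^ p) b'"
      using inj tb(5) by (metis injD)
    define e where "e = b + scale_coeffs (-1) b'"
    have "(times_normsq ^^ p) e = t' + scale_coeffs (-1) t"
    proof (rule poly_mapping_eqI)
      fix \<alpha>
      from eq have "lookup (t + (times_normsq ^^ p) b) \<alpha> = lookup (t' + (times_normsq ^^ p) b') \<alpha>"
        by simp
      then show "lookup ((times_normsq ^^ p) e) \<alpha> = lookup (t' + scale_coeffs (-1) t) \<alpha>"
        by (simp add: e_def times_normsq_pow_add times_normsq_pow_scale lookup_add scale_coeffs.rep_eq algebra_simps)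
    qed
    moreover from this have "(times_normsq ^^ p) e = 0"
      by (intro polyharmonic_multiple_of_normsq_eq_0)
        (simp add: laplace_pow_add laplace_pow_scale t'b' tb)
    ultimately have 0: "t' + scale_coeffs (-1) t = 0" by simp
    have "t' = t"
    proof (rule poly_mapping_eqI)
      fix \<alpha>
      from 0 have "lookup (t' + scale_coeffs (-1) t) \<alpha> = 0" by simp
      then show "lookup t' \<alpha> = lookup t \<alpha>" by (simp add: lookup_add scale_coeffs.rep_eq)
    qed
    with eq t'b' show "fg = (ev t, ev ((times_normsq ^^ p) b))"
      by (simp add: prod_eq_iff)
  qed
qed

lemma polyharmonic_real_eq:
  "polyharmonic_real p m = {rpoly a | a. homogeneous_coeffs m a \<and> (laplace ^^ p) a = 0}"
proof -
  have "rpoly a = (\<lambda>x. 0) \<longleftrightarrow> a = 0" for a :: "'a coeffs"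
  proof
    assume "rpoly a = (\<lambda>x. 0)"
    then have "rpoly a x = 0" for x by (simp add: rpoly_def)
    then show "a = 0" by (rule rpoly_eq_0_imp)
  qed (simp add: fun_eq_iff rpoly_def)
  then have "(laplacian_real ^^ p) (rpoly a) = (\<lambda>x. 0) \<longleftrightarrow> (laplace ^^ p) a = 0" for a :: "'a coeffs"
    unfolding laplacian_real_pow_rpoly .
  then show ?thesis
    unfolding polyharmonic_real_def hom_polys_real_def by blast
qed

lemma polyharmonic_complex_eq:
  "polyharmonic_complex p m = {cpoly a | a. homogeneous_coeffs m a \<and> (laplace ^^ p) a = 0}"
proof -
  have "cpoly a = (\<lambda>x. 0) \<longleftrightarrow> a = 0" for a :: "'a coeffs"
  proof
    assume "cpoly a = (\<lambda>x. 0)"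
    then have "rpoly a x = 0" for x by (simp add: rpoly_def)
    then show "a = 0" by (rule rpoly_eq_0_imp)
  qed (simp add: fun_eq_iff rpoly_def)
  then have "(laplacian_complex ^^ p) (cpoly a) = (\<lambda>x. 0) \<longleftrightarrow> (laplace ^^ p) a = 0" for a :: "'a coeffs"
    unfolding laplacian_complex_pow_cpoly .
  then show ?thesis
    unfolding polyharmonic_complex_def hom_polys_complex_def by blast
qed

theorem theorem1:
  fixes d :: "nat \<Rightarrow> nat \<Rightarrow> ('n::finite \<Rightarrow> nat) \<Rightarrow> complex"
    and p m :: nat
  assumes "CARD('n) \<ge> 2" and "p \<ge> 1" and "m \<ge> 2 * p"
    and "representing_constants m d"
  shows "(\<forall>u \<in> hom_polys_real m. Q_map d p m u \<in> polyharmonic_real p m \<and>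
            (\<forall>x. x \<noteq> 0 \<longrightarrow> Q_map d p m u x = Q_formula d p m u x)) \<and>
         canonical_projection_real p m (Q_map d p m) \<and>
         canonical_projection_complex p m (natural_extension (Q_map d p m))"
proof (intro conjI)
  note Q = Q_map_rpoly[OF assms(1,3,4)]
  show "\<forall>u \<in> hom_polys_real m. Q_map d p m u \<in> polyharmonic_real p m \<and>
            (\<forall>x. x \<noteq> 0 \<longrightarrow> Q_map d p m u x = Q_formula d p m u x)"
  proof
    fix u :: "real^'n \<Rightarrow> complex" assume "u \<in> hom_polys_real m"
    then obtain a where a: "u = rpoly a" "homogeneous_coeffs m a" unfolding hom_polys_real_def by blast
    obtain t where t: "Q_map d p m u = rpoly t" "\<forall>x. x \<noteq> 0 \<longrightarrow> Q_formula d p m u x = rpoly t x"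
        "homogeneous_coeffs m t" "(laplace ^^ p) t = 0"
      using Q[OF a(2)] a(1) by blast
    then show "Q_map d p m u \<in> polyharmonic_real p m \<and>
        (\<forall>x. x \<noteq> 0 \<longrightarrow> Q_map d p m u x = Q_formula d p m u x)"
      unfolding polyharmonic_real_eq by auto
  qed
  have "is_projection_along {rpoly a | a :: 'n coeffs. homogeneous_coeffs m a}
    {rpoly a | a. homogeneous_coeffs m a \<and> (laplace ^^ p) a = 0}
    {rpoly ((times_normsq ^^ p) b) | b. homogeneous_coeffs (m - 2 * p) b} (Q_map d p m)"
    using Q by (intro is_projection_along_coeffs inj_rpoly ext rpoly_add assms(3)) meson
  moreover have "(\<lambda>g x. of_real (norm x ^ (2 * p)) * g x) ` hom_polys_real (m - 2 * p)
      = {rpoly ((times_normsq ^^ p) b) | b :: 'n coeffs. homogeneous_coeffs (m - 2 * p) b}"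
    unfolding hom_polys_real_def by (auto simp: fun_eq_iff rpoly_times_normsq_pow image_def)
  ultimately show "canonical_projection_real p m (Q_map d p m)"
    unfolding canonical_projection_real_def polyharmonic_real_eq hom_polys_real_def by simp
  have "natural_extension (Q_map d p m) (cpoly a) = cpoly t" if "Q_map d p m (rpoly a) = rpoly t" for a t
  proof -
    have "cpoly a \<circ> of_real_vec = rpoly a" by (simp add: fun_eq_iff rpoly_def)
    with that show ?thesis
      by (simp add: natural_extension_def complexify_def coeffs_of_rpoly)
  qed
  then have "is_projection_along {cpoly a | a :: 'n coeffs. homogeneous_coeffs m a}
    {cpoly a | a. homogeneous_coeffs m a \<and> (laplace ^^ p) a = 0}
    {cpoly ((times_normsq ^^ p) b) | b. homogeneous_coeffs (m - 2 * p) b} (natural_extension (Q_map d p m))"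
    using Q by (intro is_projection_along_coeffs inj_cpoly ext cpoly_add assms(3)) meson
  moreover have "(\<lambda>g z. (\<Sum>j\<in>UNIV. (z $ j)\<^sup>2) ^ p * g z) ` hom_polys_complex (m - 2 * p)
      = {cpoly ((times_normsq ^^ p) b) | b :: 'n coeffs. homogeneous_coeffs (m - 2 * p) b}"
    unfolding hom_polys_complex_def by (auto simp: fun_eq_iff cpoly_times_normsq_pow image_def)
  ultimately show "canonical_projection_complex p m (natural_extension (Q_map d p m))"
    unfolding canonical_projection_complex_def polyharmonic_complex_eq hom_polys_complex_def by simp
qed

end
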